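(* Let $H_0$ be the oriented forest with vertex set $\{x,y,z,u,w,\bar{x},\bar{z},\bar{u},\bar{w}\}$ and edge set $\{xy,zx,zu,wz,\bar{z}\bar{x},\bar{z}\bar{u},\bar{w}\bar{z}\}$ (where $ab$ denotes an edge directed from $a$ to $b$). Let $\beta_0:V(H_0)\to[0,1]$ be a function with $\sum_{v\in V(H_0)}\beta_0(v)=1$ and $\beta_0(y)\geqslant\beta_0(x)$, set $X_0=\{x,\bar{x}\}$, and set $\gamma=\max\{\beta_0(x)+\beta_0(\bar{x}),\beta_0(z)+\beta_0(\bar{z})\}$. Let $\mathcal{H}_0=(H_0,X_0,\beta_0)$. Then $\{\mathcal{H}_0\}$ is $\gamma$-good.
   Context: A distillation is a triple $(F,X,\beta)$ where $F$ is an oriented forest, $X\subseteq V(F)$ contains precisely one vertex of each component of $F$, and $\beta:V(F)\to[0,1]$ satisfies $\sum_{v\in V(F)}\beta(v)=1$; for $A\subseteq V(F)$ write $\beta(A)=\sum_{v\in A}\beta(v)$. A complete looped digraph on $[r]$ has an edge $(i,j)$ for every ordered pair in $[r]^2$, including loops; edge weights $d(i,j)\in[0,1]$ are $\epsilon$-complete if for each $j\in[r]$, $d(j,j)=1$ and for all but at most $\epsilon r$ values $i\in[r]\setminus\{j\}$, $d(i,j)+d(j,i)=1$. A map $\phi:V(F)\to[r]$ is a homomorphism from $F$ to $D$ if $d(\phi(v),\phi(w))>0$ whenever $vw\in E(F)$. Given $\gamma\geqslant0$ and distillations $\mathcal{F}_i=(F_i,X_i,\beta_i)$, $i\in[m]$,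 the set $\{\mathcal{F}_i\}_{i=1}^m$ is $\gamma$-good if for every $\alpha>0$ there exists $\epsilon_0>0$ such that for every $\epsilon\in(0,\epsilon_0]$ there exists $r_0$ such that for every $r\geqslant r_0$ and every complete looped digraph $D$ on $[r]$ with $\epsilon$-complete edge weights, there exist $j_t\in[r]$ and a random pair $(\phi,i(\phi))$ such that: (1) with probability 1, $i(\phi)\in[m]$, $\phi$ is a homomorphism from $F_{i(\phi)}$ to $D$, and $j_t\notin\phi(X_{i(\phi)})$; (2) for each $j\in[r]$, $\mathbb{E}(\beta_{i(\phi)}(\phi^{-1}(j)))\leqslant\frac{1+\gamma+\alpha}{r}$; (3) for each $j\in[r]$, $\mathbb{E}(\beta_{i(\phi)}(\phi^{-1}(j)\cap X_{i(\phi)}))\leqslant d(j_t,j)\cdot\frac{1+\gamma+\alpha}{r}$. *)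

theory Defs
  imports "Graph_Theory.Digraph_Component" "HOL-Probability.Probability"
begin

(* The library's forest predicate only excludes directed cycles, so acyclicity is stated for the
   underlying graph instead. In that symmetric digraph every edge gives the closed walk u, v, u,
   which the library counts as a cycle; hence the length bound. *)
definition oriented_forest :: "'v pair_pre_digraph \<Rightarrow> bool" where
  "oriented_forest F \<longleftrightarrow>
     pair_digraph F \<and> antisym (parcs F) \<and>
     \<not> (\<exists>p. pre_digraph.cycle (with_proj (mk_symmetric (with_proj F))) p \<and> 3 \<le> length p)"

definition component_verts :: "'v pair_pre_digraph \<Rightarrow> 'v set set" where
  "component_verts F = pre_digraph.sccs_verts (with_proj (mk_symmetric (with_proj F)))"

record 'v distillation_data =
  dforest :: "'v pair_pre_digraph"
  droots :: "'v set"
  dweight :: "'v \<Rightarrow> real"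

definition distillation :: "'v distillation_data \<Rightarrow> bool" where
  "distillation \<F> \<longleftrightarrow>
     oriented_forest (dforest \<F>) \<and>
     droots \<F> \<subseteq> pverts (dforest \<F>) \<and>
     (\<forall>C \<in> component_verts (dforest \<F>). \<exists>!v. v \<in> droots \<F> \<inter> C) \<and>
     dweight \<F> \<in> pverts (dforest \<F>) \<rightarrow> {0..1} \<and>
     (\<Sum>v \<in> pverts (dforest \<F>). dweight \<F> v) = 1"

(* The complete looped digraph on {1..r} is determined by r, so a weighted one is given by r
   together with d; values of d outside {1..r} play no role. *)
definition eps_complete :: "real \<Rightarrow> nat \<Rightarrow> (nat \<Rightarrow> nat \<Rightarrow> real) \<Rightarrow> bool" where
  "eps_complete \<epsilon> r d \<longleftrightarrow>
     (\<forall>i \<in> {1..r}. \<forall>j \<in> {1..r}. d i j \<in> {0..1}) \<and>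
     (\<forall>j \<in> {1..r}. d j j = 1 \<and>
        real (card {i \<in> {1..r} - {j}. d i j + d j i \<noteq> 1}) \<le> \<epsilon> * real r)"

definition weighted_hom ::
    "'v pair_pre_digraph \<Rightarrow> nat \<Rightarrow> (nat \<Rightarrow> nat \<Rightarrow> real) \<Rightarrow> ('v \<Rightarrow> nat) \<Rightarrow> bool" where
  "weighted_hom F r d \<phi> \<longleftrightarrow>
     \<phi> \<in> pverts F \<rightarrow>\<^sub>E {1..r} \<and> (\<forall>(v, w) \<in> parcs F. d (\<phi> v) (\<phi> w) > 0)"

definition fibre :: "'v pair_pre_digraph \<Rightarrow> ('v \<Rightarrow> nat) \<Rightarrow> nat \<Rightarrow> 'v set" where
  "fibre F \<phi> j = {v \<in> pverts F. \<phi> v = j}"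

(* Almost surely the random pair takes one of finitely many values (homomorphisms are extensional
   on a finite vertex set), so probability mass functions capture all its possible laws. *)
definition gamma_good :: "real \<Rightarrow> nat \<Rightarrow> (nat \<Rightarrow> 'v distillation_data) \<Rightarrow> bool" where
  "gamma_good \<gamma> m \<F> \<longleftrightarrow>
     0 \<le> \<gamma> \<and> (\<forall>i \<in> {1..m}. distillation (\<F> i)) \<and>
     (\<forall>\<alpha>>0. \<exists>\<epsilon>\<^sub>0>0. \<forall>\<epsilon>. 0 < \<epsilon> \<and> \<epsilon> \<le> \<epsilon>\<^sub>0 \<longrightarrow>
       (\<exists>r\<^sub>0. \<forall>r\<ge>r\<^sub>0. \<forall>d. eps_complete \<epsilon> r d \<longrightarrow>
         (\<exists>j\<^sub>t \<in> {1..r}. \<exists>P :: (('v \<Rightarrow> nat) \<times> nat) pmf.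
           (AE (\<phi>, i) in measure_pmf P.
              i \<in> {1..m} \<and> weighted_hom (dforest (\<F> i)) r d \<phi> \<and> j\<^sub>t \<notin> \<phi> ` droots (\<F> i)) \<and>
           (\<forall>j \<in> {1..r}.
              measure_pmf.expectation P
                (\<lambda>(\<phi>, i). \<Sum>v \<in> fibre (dforest (\<F> i)) \<phi> j. dweight (\<F> i) v)
              \<le> (1 + \<gamma> + \<alpha>) / real r) \<and>
           (\<forall>j \<in> {1..r}.
              measure_pmf.expectation P
                (\<lambda>(\<phi>, i). \<Sum>v \<in> fibre (dforest (\<F> i)) \<phi> j \<inter> droots (\<F> i). dweight (\<F> i) v)
              \<le> d j\<^sub>t j * ((1 + \<gamma> + \<alpha>) / real r)))))"

(* A trailing b stands for a bar. *)
datatype H0_vertex = Vx | Vy | Vz | Vu | Vw | Vxb | Vzb | Vub | Vwb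

definition H0 :: "H0_vertex pair_pre_digraph" where
  "H0 = \<lparr> pverts = {Vx, Vy, Vz, Vu, Vw, Vxb, Vzb, Vub, Vwb},
          parcs = {(Vx, Vy), (Vz, Vx), (Vz, Vu), (Vw, Vz),
                   (Vzb, Vxb), (Vzb, Vub), (Vwb, Vzb)} \<rparr>"

end

theory Submission
  imports Defs
begin

text \<open>
  For a fixed \<open>j\<^sub>t\<close>, a random homomorphism as required exists if every system of prices, \<open>\<rho> j\<close> for
  constraint (2) and \<open>\<mu> j\<close> for constraint (3), is met by a single homomorphism whose cost is at most
  the budget (minimax; an approximate version suffices and is proved by a potential argument).

  Let \<open>v\<close> have maximal out-degree and suppose that all homomorphisms cost more than \<open>C\<close>. Split each
  vertex \<open>j\<close> into an out-part of mass \<open>d v j\<close>, the only place for \<open>x\<close>, and an in-part of mass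
  \<open>1 - d v j\<close>. Folding \<open>H\<^sub>0\<close> onto a vertex \<open>a\<close> of the out-part shows that \<open>a\<close> is expensive. Folding it
  onto an arc \<open>(a, b)\<close> with \<open>y, u\<close> at \<open>b\<close>, or onto an arc \<open>(b, a)\<close> with \<open>w, z, u\<close> at \<open>b\<close>, shows
  that cheap vertices \<open>b\<close> force even larger prices on their neighbours \<open>a\<close> in the out-part. If each of
  the sets \<open>{y, u}\<close> and \<open>{w, z, u}\<close> has weight at least \<open>(1 - \<gamma>) / 2\<close>, looking at the cheapest \<open>b\<close> is
  enough to exceed the budget. If the second weight is small, one also uses that at least half of any
  set \<open>V\<close> is matched by in-neighbours in the out-part, because \<open>v\<close> has maximal out-degree.

  If \<open>{y, u}\<close> is light, \<open>v\<close> itself may fail, but then there is a large set \<open>V\<close> with few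
  out-neighbours in the out-part of \<open>v\<close>; let \<open>K\<close> be the rest of that out-part, so that \<open>K\<close> dominates
  \<open>V\<close>. A vertex of \<open>K\<close> (chosen to dominate also the vertices with few out-neighbours in \<open>K\<close>) then
  works as \<open>j\<^sub>t\<close>: put \<open>x, y\<close> into \<open>V\<close>, \<open>z, u\<close> into \<open>K\<close>, and \<open>w\<close> anywhere.
\<close>

section \<open>Price inequalities and random responses\<close>

text \<open>
  Slicing \<open>f\<close> into level sets turns the Hall-type condition with deficiency \<open>K\<close> into an inequality
  between price sums, so no actual flow has to be constructed.
\<close>
lemma layer_cake_hall:
  fixes f p :: "'a \<Rightarrow> real" and G q :: "'b \<Rightarrow> real"
  assumes "finite S" "finite A"
    and "\<And>j. j \<in> S \<Longrightarrow> 0 \<le> f j" "\<And>j. j \<in> S \<Longrightarrow> f j \<le> M" "0 \<le> M"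
    and "\<And>a. a \<in> A \<Longrightarrow> 0 \<le> G a" "\<And>a. a \<in> A \<Longrightarrow> 0 \<le> q a" "0 \<le> \<kappa>" "0 \<le> K"
    and "\<And>j a. j \<in> S \<Longrightarrow> a \<in> A \<Longrightarrow> R j a \<Longrightarrow> \<kappa> * f j \<le> G a"
    and "\<And>V. V \<subseteq> S \<Longrightarrow> V \<noteq> {} \<Longrightarrow> (\<Sum>j\<in>V. p j) \<le> K + \<kappa> * (\<Sum>a | a \<in> A \<and> (\<exists>j\<in>V. R j a). q a)"
  shows "(\<Sum>j\<in>S. p j * f j) \<le> K * M + (\<Sum>a\<in>A. q a * G a)"
  using assms
proof (induction "card {j \<in> S. 0 < f j}" arbitrary: f G M rule: less_induct)
  case less
  note fin = less.prems(1,2) and f0 = less.prems(3) and fM = less.prems(4) and M0 = less.prems(5)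
    and G0 = less.prems(6) and q0 = less.prems(7) and k0 = less.prems(8) and K0 = less.prems(9)
    and fG = less.prems(10) and hall = less.prems(11)
  define V where "V = {j \<in> S. 0 < f j}"
  have finV: "finite V" and VS: "V \<subseteq> S" using fin by (auto simp: V_def)
  show ?case
  proof (cases "V = {}")
    case True
    then have "f j = 0" if "j \<in> S" for j using f0[OF that] that by (force simp: V_def)
    then have "(\<Sum>j\<in>S. p j * f j) = 0" by simp
    moreover have "0 \<le> (\<Sum>a\<in>A. q a * G a)" by (intro sum_nonneg mult_nonneg_nonneg q0 G0)
    ultimately show ?thesis using K0 M0 by simp
  next
    case False
    define T where "T = {a \<in> A. \<exists>j\<in>V. R j a}"
    \<comment> \<open>The bottom layer has support \<open>V\<close> and height \<open>m\<close>, the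
      least positive value of \<open>f\<close>. Removing it makes \<open>f\<close> vanish where the
      minimum is attained, so the support shrinks; the Hall inequality for \<open>V\<close> pays for
      the layer.\<close>
    define m where "m = Min (f ` V)"
    have m_in: "m \<in> f ` V" unfolding m_def using finV False by (intro Min_in) auto
    have m_le: "m \<le> f j" if "j \<in> V" for j unfolding m_def using finV that by auto
    have m0: "0 < m" using m_in by (auto simp: V_def)
    define f' where "f' j = (if j \<in> V then f j - m else 0)" for j
    define G' where "G' a = (if a \<in> T then G a - \<kappa> * m else G a)" for a
    have GT: "\<kappa> * m \<le> G a" if "a \<in> T" for a
    proof -
      from that obtain j where j: "j \<in> V" "R j a" "a \<in> A" by (auto simp: T_def)
      have "\<kappa> * m \<le> \<kappa> * f j" using m_le[OF j(1)] k0 by (intro mult_left_mono)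
      also have "\<dots> \<le> G a" using fG j VS by auto
      finally show ?thesis .
    qed
    have "{j \<in> S. 0 < f' j} \<subset> V"
    proof -
      from m_in obtain j where "j \<in> V" "f j = m" by auto
      then show ?thesis by (auto simp: f'_def V_def)
    qed
    then have card: "card {j \<in> S. 0 < f' j} < card {j \<in> S. 0 < f j}"
      using finV psubset_card_mono unfolding V_def[symmetric] by blast
    have mM: "m \<le> M" using m_in fM VS by auto
    have IH: "(\<Sum>j\<in>S. p j * f' j) \<le> K * (M - m) + (\<Sum>a\<in>A. q a * G' a)"
    proof (rule less.hyps[OF card fin _ _ _ _ q0 k0 K0 _ hall])
      show "0 \<le> f' j" if "j \<in> S" for j using m_le by (auto simp: f'_def)
      show "f' j \<le> M - m" if "j \<in> S" for j using that fM[OF that] mM by (auto simp: f'_def)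
      show "0 \<le> M - m" using mM by simp
      show "0 \<le> G' a" if "a \<in> A" for a using that G0 GT[of a] by (auto simp: G'_def)
      show "\<kappa> * f' j \<le> G' a" if "j \<in> S" "a \<in> A" "R j a" for j a
        using that fG[OF that] G0[OF that(2)] GT[of a]
        by (auto simp: f'_def G'_def T_def algebra_simps)
    qed auto
    have "(\<Sum>j\<in>S. p j * f j) = (\<Sum>j\<in>S. p j * f' j + (if j \<in> V then p j * m else 0))"
      using f0 by (intro sum.cong) (force simp: f'_def V_def algebra_simps)+
    also have "\<dots> = (\<Sum>j\<in>S. p j * f' j) + m * (\<Sum>j\<in>V. p j)"
      using fin VS by (simp add: sum.distrib sum.If_cases sum_distrib_left mult.commute Int_absorb1)
    also have "\<dots> \<le> K * (M - m) + (\<Sum>a\<in>A. q a * G' a) + m * (K + \<kappa> * (\<Sum>a\<in>T. q a))"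
      using IH hall[OF VS False] m0 unfolding T_def by (intro add_mono mult_left_mono) auto
    also have "\<dots> = K * M + ((\<Sum>a\<in>A. q a * G' a) + (\<Sum>a\<in>T. q a * (\<kappa> * m)))"
      by (simp add: algebra_simps sum_distrib_left)
    also have "(\<Sum>a\<in>T. q a * (\<kappa> * m)) = (\<Sum>a\<in>A. if a \<in> T then q a * (\<kappa> * m) else 0)"
      using fin by (simp add: sum.If_cases T_def Int_def)
    also have "(\<Sum>a\<in>A. q a * G' a) + \<dots> = (\<Sum>a\<in>A. q a * G a)"
      unfolding sum.distrib[symmetric] by (intro sum.cong) (auto simp: G'_def algebra_simps)
    finally show ?thesis .
  qed
qed

text \<open>
  Respond to the positive part of the accumulated excess: its squared norm then grows at most
  linearly, so that the average excess after \<open>n\<close> rounds is of order \<open>1 / \<surd>n\<close>.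
\<close>
lemma approachability:
  fixes f :: "'a \<Rightarrow> 'i \<Rightarrow> real" and c :: "'i \<Rightarrow> real"
  assumes "finite I" "finite \<Phi>" "0 < \<delta>"
    and price: "\<And>w. (\<And>i. i \<in> I \<Longrightarrow> 0 \<le> w i) \<Longrightarrow>
      \<exists>\<phi>\<in>\<Phi>. (\<Sum>i\<in>I. w i * f \<phi> i) \<le> (\<Sum>i\<in>I. w i * c i)"
  shows "\<exists>P. set_pmf P \<subseteq> \<Phi> \<and> (\<forall>i\<in>I. measure_pmf.expectation P (\<lambda>\<phi>. f \<phi> i) \<le> c i + \<delta>)"
proof -
  define pick where "pick s = (SOME \<phi>. \<phi> \<in> \<Phi> \<and>
    (\<Sum>i\<in>I. max 0 (s i) * f \<phi> i) \<le> (\<Sum>i\<in>I. max 0 (s i) * c i))" for s :: "'i \<Rightarrow> real"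
  have pick: "pick s \<in> \<Phi>" "(\<Sum>i\<in>I. max 0 (s i) * f (pick s) i) \<le> (\<Sum>i\<in>I. max 0 (s i) * c i)" for s
    using someI_ex[of "\<lambda>\<phi>. \<phi> \<in> \<Phi> \<and>
        (\<Sum>i\<in>I. max 0 (s i) * f \<phi> i) \<le> (\<Sum>i\<in>I. max 0 (s i) * c i)"] price[of "\<lambda>i. max 0 (s i)"]
    unfolding pick_def by auto
  define S where "S = rec_nat (\<lambda>_. 0) (\<lambda>_ s i. s i + f (pick s) i - c i)"
  have S0: "S 0 i = 0" and SSuc: "S (Suc n) i = S n i + f (pick (S n)) i - c i" for n i
    by (simp_all add: S_def)
  have "\<Phi> \<noteq> {}" using pick(1) by blast
  define B where "B = Max ((\<lambda>\<phi>. \<Sum>i\<in>I. (f \<phi> i - c i)\<^sup>2) ` \<Phi>)"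
  have B: "(\<Sum>i\<in>I. (f \<phi> i - c i)\<^sup>2) \<le> B" if "\<phi> \<in> \<Phi>" for \<phi>
    unfolding B_def using that assms(2) by (intro Max_ge) auto
  have energy: "(\<Sum>i\<in>I. (max 0 (S n i))\<^sup>2) \<le> real n * B" for n
  proof (induction n)
    case 0
    then show ?case by (simp add: S0)
  next
    case (Suc n)
    let ?\<phi> = "pick (S n)"
    have step: "(max 0 (s + t))\<^sup>2 \<le> (max 0 s)\<^sup>2 + 2 * (max 0 s * t) + t\<^sup>2" for s t :: real
    proof -
      have "max 0 (s + t) \<le> \<bar>max 0 s + t\<bar>" by auto
      then have "(max 0 (s + t))\<^sup>2 \<le> (max 0 s + t)\<^sup>2"
        by (metis abs_le_square_iff abs_of_nonneg max.cobounded1)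
      then show ?thesis by (simp add: power2_eq_square algebra_simps)
    qed
    have "(\<Sum>i\<in>I. (max 0 (S (Suc n) i))\<^sup>2)
      \<le> (\<Sum>i\<in>I. (max 0 (S n i))\<^sup>2 + 2 * (max 0 (S n i) * (f ?\<phi> i - c i)) + (f ?\<phi> i - c i)\<^sup>2)"
      unfolding SSuc using step[of "S n _" "f ?\<phi> _ - c _"] by (intro sum_mono) (simp add: algebra_simps)
    also have "\<dots> = (\<Sum>i\<in>I. (max 0 (S n i))\<^sup>2)
        + 2 * ((\<Sum>i\<in>I. max 0 (S n i) * f ?\<phi> i) - (\<Sum>i\<in>I. max 0 (S n i) * c i))
        + (\<Sum>i\<in>I. (f ?\<phi> i - c i)\<^sup>2)"
      by (simp add: sum.distrib sum_distrib_left[symmetric] sum_subtractf right_diff_distrib)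
    \<comment> \<open>The cross term is at most 0 by the choice of \<open>pick\<close>, so each
      round adds at most \<open>B\<close>.\<close>
    also have "\<dots> \<le> real n * B + B"
    proof -
      have "a + 2 * (x - y) + t \<le> N + T" if "a \<le> N" "x \<le> y" "t \<le> T" for a x y t N T :: real
        using that by simp
      then show ?thesis using Suc pick(2)[of "S n"] B[OF pick(1), of "S n"] by blast
    qed
    finally show ?case by (simp add: algebra_simps)
  qed
  obtain n0 :: nat where n0: "B / \<delta>\<^sup>2 \<le> real n0" using real_arch_simple by blast
  \<comment> \<open>With \<open>B\<close> at most \<open>real n * \<delta>\<^sup>2\<close>, the
    energy bound puts every coordinate of \<open>S n\<close> below \<open>\<delta> * real n\<close>.
    The successor keeps \<open>n\<close> positive even if \<open>B\<close> is 0.\<close>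
  define n where "n = Suc n0"
  have "B \<le> real n0 * \<delta>\<^sup>2" using n0 assms(3) by (simp add: field_simps)
  also have "\<dots> \<le> real n * \<delta>\<^sup>2" by (intro mult_right_mono) (auto simp: n_def)
  finally have nB: "B \<le> real n * \<delta>\<^sup>2" .
  have n: "0 < n" by (simp add: n_def)
  have Sn: "S n i \<le> \<delta> * real n" if "i \<in> I" for i
  proof -
    have "(max 0 (S n i))\<^sup>2 \<le> (\<Sum>i\<in>I. (max 0 (S n i))\<^sup>2)"
      using that assms(1) by (intro member_le_sum) auto
    also have "\<dots> \<le> real n * B" by (rule energy)
    also have "\<dots> \<le> real n * (real n * \<delta>\<^sup>2)" using nB by (intro mult_left_mono) auto
    also have "\<dots> = (\<delta> * real n)\<^sup>2" by (simp add: power2_eq_square)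
    finally have "max 0 (S n i) \<le> \<delta> * real n" using assms(3) by (auto intro: power2_le_imp_le)
    then show ?thesis by simp
  qed
  have Ssum: "S k i = (\<Sum>t<k. f (pick (S t)) i) - real k * c i" for k i
    by (induction k) (auto simp: S0 SSuc algebra_simps)
  define P where "P = map_pmf (\<lambda>k. pick (S k)) (pmf_of_set {..<n})"
  have "{..<n} \<noteq> {}" using n by auto
  then have "measure_pmf.expectation P (\<lambda>\<phi>. f \<phi> i) = (\<Sum>t<n. f (pick (S t)) i) / real n" for i
    unfolding P_def by (simp add: integral_pmf_of_set)
  moreover have "(\<Sum>t<n. f (pick (S t)) i) / real n \<le> c i + \<delta>" if "i \<in> I" for i
    using Sn[OF that] n Ssum[of n i] by (simp add: field_simps)
  moreover have "set_pmf P \<subseteq> \<Phi>" using pick(1) by (auto simp: P_def)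
  ultimately show ?thesis by auto
qed

section \<open>The forest \<open>H\<^sub>0\<close>\<close>

text \<open>A vertex of largest rank on a long cycle would have two distinct neighbours of no larger rank.\<close>
lemma no_long_cycle_if_ranked:
  fixes rank :: "'v \<Rightarrow> nat"
  assumes rank: "\<And>a b c. (a, b) \<in> parcs G \<Longrightarrow> (b, c) \<in> parcs G \<Longrightarrow> rank a \<le> rank b \<Longrightarrow>
      rank c \<le> rank b \<Longrightarrow> a = c"
    and cyc: "pre_digraph.cycle (with_proj G) p"
  shows "length p < 3"
proof (rule ccontr)
  assume "\<not> length p < 3"
  then have n3: "3 \<le> length p" by simp
  define n where "n = length p"
  define e where "e k = p ! (k mod n)" for k
  have n0: "0 < n" using n3 unfolding n_def by linarith
  from cyc obtain u where u: "set p \<subseteq> parcs G" "pre_digraph.cas (with_proj G) u p u"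
      "distinct (tl (pre_digraph.awalk_verts (with_proj G) u p))" "p \<noteq> []"
    unfolding pre_digraph.cycle_def pre_digraph.awalk_def by auto
  have "tl (pre_digraph.awalk_verts (with_proj G) u p) = map snd p"
    using pre_digraph.awalk_verts_conv'[OF u(2)] u(4) by simp
  then have dist: "distinct (map snd p)" using u(3) by simp
  have cas_nth: "(\<forall>k. Suc k < length q \<longrightarrow> snd (q ! k) = fst (q ! Suc k)) \<and>
      (q \<noteq> [] \<longrightarrow> fst (q ! 0) = a \<and> snd (q ! (length q - 1)) = b)"
    if "pre_digraph.cas (with_proj G) a q b" for a b q
    using that
  proof (induction q arbitrary: a)
    case (Cons x q)
    then have x: "fst x = a" "pre_digraph.cas (with_proj G) (snd x) q b"
      by (simp_all add: pre_digraph.cas.simps)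
    from Cons.IH[OF x(2)] x show ?case
      by (cases q) (auto simp: nth_Cons pre_digraph.cas.simps split: nat.split)
  qed (simp add: pre_digraph.cas.simps)
  have step: "snd (e k) = fst (e (Suc k))" for k
  proof (cases "Suc (k mod n) < n")
    case True
    then show ?thesis using cas_nth[OF u(2)] by (simp add: e_def n_def mod_Suc)
  next
    case False
    then have "k mod n = n - 1" using mod_less_divisor[OF n0, of k] by linarith
    then show ?thesis using cas_nth[OF u(2)] u(4) n0 by (simp add: e_def n_def mod_Suc)
  qed
  have eG: "e k \<in> parcs G" for k
    using u(1) n0 by (auto simp: e_def n_def intro!: subsetD[OF u(1)] nth_mem)
  obtain k where k: "k < n" "\<And>i. i < n \<Longrightarrow> rank (snd (e i)) \<le> rank (snd (e k))"
  proof -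
    have "finite ((\<lambda>i. rank (snd (e i))) ` {..<n})" by simp
    from Max_in[OF this] n0 obtain k where "k < n" "rank (snd (e k)) = Max ((\<lambda>i. rank (snd (e i))) ` {..<n})"
      by fastforce
    then show ?thesis using that Max_ge[OF \<open>finite _\<close>] by auto
  qed
  have k': "rank (snd (e i)) \<le> rank (snd (e k))" for i
    using k(2)[of "i mod n"] n0 by (simp add: e_def)
  \<comment> \<open>The cyclic predecessor of \<open>k\<close>; adding \<open>n\<close> first avoids
    truncated subtraction at 0.\<close>
  define j where "j = k + n - 1"
  have j: "Suc j = k + n" using n0 by (simp add: j_def)
  have ek: "e (Suc j) = e k" by (simp add: j e_def)
  have "fst (e k) = snd (e j)" using step[of j] ek by simp
  moreover have "(fst (e k), snd (e k)) \<in> parcs G" using eG[of k] by simp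
  moreover have "(snd (e k), snd (e (Suc k))) \<in> parcs G" using eG[of "Suc k"] step[of k] by simp
  ultimately have "snd (e j) = snd (e (Suc k))" using rank[of "snd (e j)" "snd (e k)"] k' by metis
  \<comment> \<open>Heads of arcs on a cycle are distinct, so the positions just before and just
    after \<open>k\<close> agree modulo \<open>n\<close>. This forces \<open>n\<close> to divide
    2.\<close>
  then have "j mod n = Suc k mod n"
    using dist mod_less_divisor[OF n0] unfolding e_def n_def distinct_conv_nth
    by (metis length_map nth_map)
  then have "(Suc k + 1) mod n = (j + 1) mod n" by (metis mod_add_left_eq)
  then have "(k + 2) mod n = k mod n" by (simp add: j)
  then have "n dvd 2" by (metis add_diff_cancel_left' le_add1 mod_eq_dvd_iff_nat)
  then show False using n3 dvd_imp_le[of n 2] by (simp add: n_def)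
qed

lemma parcs_mk_symmetric_H0:
  "parcs (mk_symmetric (with_proj H0)) =
    {(Vx, Vy), (Vz, Vx), (Vz, Vu), (Vw, Vz), (Vzb, Vxb), (Vzb, Vub), (Vwb, Vzb),
     (Vy, Vx), (Vx, Vz), (Vu, Vz), (Vz, Vw), (Vxb, Vzb), (Vub, Vzb), (Vzb, Vwb)}"
  by (auto simp: parcs_mk_symmetric H0_def)

lemma pair_digraph_H0: "pair_digraph H0"
  by unfold_locales (auto simp: H0_def)

text \<open>The distance to \<open>Vz\<close> or \<open>Vzb\<close> inside the component. With the
  trees rooted there, the only neighbour of no larger rank is the parent.\<close>

definition H0_rank :: "H0_vertex \<Rightarrow> nat" where
  "H0_rank v = (case v of Vx \<Rightarrow> 1 | Vy \<Rightarrow> 2 | Vz \<Rightarrow> 0 | Vu \<Rightarrow> 1 | Vw \<Rightarrow> 1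
      | Vxb \<Rightarrow> 1 | Vzb \<Rightarrow> 0 | Vub \<Rightarrow> 1 | Vwb \<Rightarrow> 1)"

lemma oriented_forest_H0: "oriented_forest H0"
proof -
  have "length p < 3" if "pre_digraph.cycle (with_proj (mk_symmetric (with_proj H0))) p" for p
    by (rule no_long_cycle_if_ranked[OF _ that, where rank = H0_rank])
      (auto simp: parcs_mk_symmetric_H0 H0_rank_def)
  moreover have "antisym (parcs H0)" by (auto simp: H0_def antisym_def)
  ultimately show ?thesis
    unfolding oriented_forest_def using pair_digraph_H0 by (auto simp: not_le[symmetric])
qed

lemma roots_H0:
  assumes "C \<in> component_verts H0"
  shows "\<exists>!v. v \<in> {Vx, Vxb} \<inter> C"
proof -
  interpret pair_digraph H0 by (rule pair_digraph_H0)
  interpret M: pair_wf_digraph "mk_symmetric (with_proj H0)"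
    by (rule wellformed_mk_symmetric)
  let ?M = "with_proj (mk_symmetric (with_proj H0))"
  \<comment> \<open>\<open>col\<close> is constant along edges of the underlying graph, and every
    vertex is joined to the root of its colour. Hence the components are the two colour classes,
    with one root each.\<close>
  define col where "col v = (v \<in> {Vx, Vy, Vz, Vu, Vw})" for v
  have sym: "symmetric ?M" by (rule symmetric_mk_symmetric)
  have adj: "a \<rightarrow>\<^sup>*\<^bsub>?M\<^esub> b" if "(a, b) \<in> parcs (mk_symmetric (with_proj H0))" for a b
    using that by (intro M.reachable_adjI) simp
  have col: "col a = col b" if "a \<rightarrow>\<^sup>*\<^bsub>?M\<^esub> b" for a b
    using that by (induction rule: M.reachable_induct) (auto simp: parcs_mk_symmetric_H0 col_def)
  have x: "v \<rightarrow>\<^sup>*\<^bsub>?M\<^esub> (if col v then Vx else Vxb)" for v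
  proof -
    have 1: "Vz \<rightarrow>\<^sup>*\<^bsub>?M\<^esub> Vx" "Vx \<rightarrow>\<^sup>*\<^bsub>?M\<^esub> Vy" "Vz \<rightarrow>\<^sup>*\<^bsub>?M\<^esub> Vu" "Vw \<rightarrow>\<^sup>*\<^bsub>?M\<^esub> Vz"
      "Vzb \<rightarrow>\<^sup>*\<^bsub>?M\<^esub> Vxb" "Vzb \<rightarrow>\<^sup>*\<^bsub>?M\<^esub> Vub" "Vwb \<rightarrow>\<^sup>*\<^bsub>?M\<^esub> Vzb"
      by (auto intro!: adj simp: parcs_mk_symmetric_H0)
    note 2 = 1[THEN symmetric_reachable[OF sym]]
    have "Vx \<in> pverts H0" "Vxb \<in> pverts H0" by (auto simp: H0_def)
    then have "Vx \<rightarrow>\<^sup>*\<^bsub>?M\<^esub> Vx" "Vxb \<rightarrow>\<^sup>*\<^bsub>?M\<^esub> Vxb" by auto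
    then show ?thesis using 1 2 by (cases v) (auto simp: col_def intro: M.reachable_trans)
  qed
  from assms have C: "C \<noteq> {}" "\<And>a b. a \<in> C \<Longrightarrow> b \<in> C \<Longrightarrow> a \<rightarrow>\<^sup>*\<^bsub>?M\<^esub> b"
    "\<And>a b. a \<in> C \<Longrightarrow> b \<notin> C \<Longrightarrow> \<not> a \<rightarrow>\<^sup>*\<^bsub>?M\<^esub> b \<or> \<not> b \<rightarrow>\<^sup>*\<^bsub>?M\<^esub> a"
    unfolding component_verts_def pre_digraph.sccs_verts_def by auto
  from C(1) obtain a where a: "a \<in> C" by auto
  let ?x = "if col a then Vx else Vxb"
  have "?x \<in> C" using C(3)[OF a, of ?x] x[of a] symmetric_reachable[OF sym x[of a]] by blast
  moreover have "b = ?x" if "b \<in> {Vx, Vxb} \<inter> C" for b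
    using col[OF C(2)[OF a, of b]] that by (auto simp: col_def)
  ultimately show ?thesis by (intro ex1I[of _ ?x]) auto
qed

lemma distillation_H0:
  assumes "\<beta> \<in> pverts H0 \<rightarrow> {0..1}" "(\<Sum>v \<in> pverts H0. \<beta> v) = 1"
  shows "distillation \<lparr> dforest = H0, droots = {Vx, Vxb}, dweight = \<beta> \<rparr>"
  unfolding distillation_def using assms oriented_forest_H0 roots_H0 by (auto simp: H0_def)

section \<open>Prices that no homomorphism meets\<close>

text \<open>The function \<open>t / (1 - t)\<close> is convex and increasing for
  \<open>t < 1\<close>, so the tangent inequalities at \<open>h\<close> for \<open>s\<close> and
  \<open>e\<close> can be added. It is used with \<open>s = fwd\<close>, \<open>e = bwd\<close> and
  \<open>h = half\<close>.\<close>

lemma odds_convex: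
  fixes s e h :: real
  assumes "s < 1" "e < 1" "h < 1" "2 * h \<le> s + e"
  shows "2 * (h / (1 - h)) \<le> s / (1 - s) + e / (1 - e)"
proof -
  have tangent: "h / (1 - h) + (t - h) / (1 - h)\<^sup>2 \<le> t / (1 - t)" if "t < 1" for t
  proof -
    have "t / (1 - t) - (h / (1 - h) + (t - h) / (1 - h)\<^sup>2) = (t - h)\<^sup>2 / ((1 - t) * (1 - h)\<^sup>2)"
      using that assms(3) by (simp add: divide_simps power2_eq_square) algebra
    moreover have "0 \<le> (t - h)\<^sup>2 / ((1 - t) * (1 - h)\<^sup>2)" using that by simp
    ultimately show ?thesis by linarith
  qed
  have "0 \<le> (s + e - 2 * h) / (1 - h)\<^sup>2" using assms(4) by simp
  moreover have "(s + e - 2 * h) / (1 - h)\<^sup>2 = (s - h) / (1 - h)\<^sup>2 + (e - h) / (1 - h)\<^sup>2"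
    by (simp add: add_divide_distrib[symmetric])
  ultimately show ?thesis using tangent[OF assms(1)] tangent[OF assms(2)] by linarith
qed

text \<open>
  The barred vertices are mapped like their unbarred counterparts, so only the total weights
  \<open>wx\<close> of \<open>x, x\<^sub>b\<close>, \<open>wz\<close> of \<open>z, z\<^sub>b\<close>, \<open>wu\<close> of \<open>u, u\<^sub>b\<close> and \<open>ww\<close> of \<open>w, w\<^sub>b\<close> matter.
\<close>
locale merged_weights =
  fixes wx wy wz wu ww \<gamma> :: real
  assumes weights_nonneg: "0 \<le> wx" "0 \<le> wy" "0 \<le> wz" "0 \<le> wu" "0 \<le> ww"
    and weights_sum: "wx + wy + wz + wu + ww = 1"
    and wx_le: "wx \<le> \<gamma>" and wz_le: "wz \<le> \<gamma>" and gamma_le: "\<gamma> \<le> 1"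
begin

text \<open>The weights that a fold onto an arc moves to its head, respectively to its tail.\<close>
definition "fwd = wy + wu"
definition "bwd = wz + wu + ww"
text \<open>Since \<open>fwd + bwd\<close> is at least \<open>1 - \<gamma>\<close>, at most one of
  the two weights lies below this threshold.\<close>

definition "half = (1 - \<gamma>) / 2"

lemma gamma_nonneg: "0 \<le> \<gamma>" using weights_nonneg wx_le by simp

lemma bwd_eq: "bwd = 1 - wx - wy" using weights_sum by (simp add: bwd_def)

end

section \<open>Digraphs with nearly complete edge weights\<close>

locale eps_digraph = merged_weights +
  fixes \<epsilon> :: real and r :: nat and d :: "nat \<Rightarrow> nat \<Rightarrow> real"
  assumes eps: "eps_complete \<epsilon> r d" and eps_pos: "0 < \<epsilon>" and r_large: "1 \<le> \<epsilon> * real r"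
begin

abbreviation "N \<equiv> {1..r}"

definition arc :: "nat \<Rightarrow> nat \<Rightarrow> bool" where "arc i j \<longleftrightarrow> 0 < d i j"

text \<open>The value at \<open>v\<close> is set to 0 because roots must avoid the target vertex,
  although its loop has weight 1.\<close>

definition out :: "nat \<Rightarrow> nat \<Rightarrow> real" where "out v j = (if j = v then 0 else d v j)"

definition outs :: "nat \<Rightarrow> nat set" where "outs v = {a \<in> N. 0 < out v a}"

definition nonadj :: "nat \<Rightarrow> nat set" where "nonadj j = {i \<in> N - {j}. d i j + d j i \<noteq> 1}"

text \<open>The five vertices encode a homomorphism that does not distinguish barred from unbarred vertices.\<close>
definition costly :: "nat \<Rightarrow> (nat \<Rightarrow> real) \<Rightarrow> (nat \<Rightarrow> real) \<Rightarrow> real \<Rightarrow> bool" where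
  "costly v \<rho> \<mu> C \<longleftrightarrow> (\<forall>x\<in>N. \<forall>y\<in>N. \<forall>z\<in>N. \<forall>u\<in>N. \<forall>w\<in>N.
     x \<noteq> v \<longrightarrow> arc v x \<longrightarrow> arc x y \<longrightarrow> arc z x \<longrightarrow> arc z u \<longrightarrow> arc w z \<longrightarrow>
     C < wx * (\<rho> x + \<mu> x) + wy * \<rho> y + wz * \<rho> z + wu * \<rho> u + ww * \<rho> w)"

lemma d_bounds: "i \<in> N \<Longrightarrow> j \<in> N \<Longrightarrow> 0 \<le> d i j" "i \<in> N \<Longrightarrow> j \<in> N \<Longrightarrow> d i j \<le> 1"
  using eps by (auto simp: eps_complete_def)

lemma d_refl: "j \<in> N \<Longrightarrow> d j j = 1"
  using eps by (auto simp: eps_complete_def)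

lemma arc_refl: "j \<in> N \<Longrightarrow> arc j j"
  by (simp add: arc_def d_refl)

lemma card_nonadj: "j \<in> N \<Longrightarrow> real (card (nonadj j)) \<le> \<epsilon> * real r"
  using eps by (auto simp: eps_complete_def nonadj_def)

lemma finite_nonadj: "finite (nonadj j)" by (simp add: nonadj_def)

lemma dominated_if_no_arc:
  assumes "i \<in> N" "j \<in> N" "i \<notin> nonadj j" "\<not> arc i j"
  shows "d j i = 1"
  using assms d_refl[OF assms(2)] d_bounds(1)[of i j] by (cases "i = j") (auto simp: nonadj_def arc_def)

lemma adjacent: "i \<in> N \<Longrightarrow> j \<in> N \<Longrightarrow> i \<notin> nonadj j \<Longrightarrow> arc i j \<or> arc j i"
  by (metis arc_def dominated_if_no_arc zero_less_one)

lemma out_bounds: "v \<in> N \<Longrightarrow> j \<in> N \<Longrightarrow> 0 \<le> out v j" "v \<in> N \<Longrightarrow> j \<in> N \<Longrightarrow> out v j \<le> 1"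
  using d_bounds by (auto simp: out_def)

lemma finite_outs: "finite (outs v)" by (simp add: outs_def)

lemma outsD: "a \<in> outs v \<Longrightarrow> a \<in> N \<and> a \<noteq> v \<and> arc v a \<and> 0 < out v a"
  by (auto simp: outs_def out_def arc_def split: if_splits)

lemma r_pos: "0 < r" using r_large by (cases r) auto

lemma sum_out_outs:
  assumes "v \<in> N"
  shows "(\<Sum>a\<in>outs v. out v a * F a) = (\<Sum>a\<in>N. out v a * F a)"
  using out_bounds(1)[OF assms] by (intro sum.mono_neutral_left) (force simp: outs_def)+

lemma sum_out_diff:
  assumes "v \<in> N" "finite B" "real (card B) \<le> \<epsilon> * real r"
  shows "(\<Sum>j\<in>N. out v j) - \<epsilon> * real r \<le> (\<Sum>j\<in>N - B. out v j)"
proof -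
  have "(\<Sum>j\<in>N. out v j) = (\<Sum>j\<in>N - B. out v j) + (\<Sum>j\<in>N \<inter> B. out v j)"
    by (subst sum.Int_Diff[of _ _ B]) auto
  moreover have "(\<Sum>j\<in>N \<inter> B. out v j) \<le> (\<Sum>j\<in>N \<inter> B. 1)"
    using out_bounds(2)[OF assms(1)] by (intro sum_mono) auto
  moreover have "real (card (N \<inter> B)) \<le> real (card B)"
    using assms(2) by (simp add: card_mono)
  ultimately show ?thesis using assms(3) by simp
qed

text \<open>Let \<open>U\<close> be the vertices of \<open>outs v\<close> without an arc into
  \<open>V\<close>. Every vertex of \<open>V\<close> sends weight 1 to almost all of
  \<open>U\<close>, and on average weight about \<open>card V / 2\<close> to \<open>V\<close>
  itself. As no out-degree exceeds that of \<open>v\<close>, which is at most the mass of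
  \<open>T\<close> plus \<open>card U\<close> plus 1, the mass of \<open>T\<close> must be nearly
  \<open>card V / 2\<close>.\<close>

lemma in_neighbourhood_of_max_outdegree:
  assumes v: "v \<in> N" "\<And>j. j \<in> N \<Longrightarrow> (\<Sum>i\<in>N. d j i) \<le> (\<Sum>i\<in>N. d v i)"
    and V: "V \<subseteq> N" "V \<noteq> {}"
  shows "real (card V) / 2 \<le> 3 * (\<epsilon> * real r) + (\<Sum>a | a \<in> outs v \<and> (\<exists>j\<in>V. arc a j). out v a)"
proof -
  define T where "T = {a \<in> outs v. \<exists>j\<in>V. arc a j}"
  define U where "U = outs v - T"
  let ?er = "\<epsilon> * real r"
  have finV: "finite V" using V finite_subset by blast
  have UN: "U \<subseteq> N" and finU: "finite U" by (auto simp: U_def outs_def)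
  have UV: "U \<inter> V = {}" using arc_refl V by (auto simp: U_def T_def outs_def)
  have to_U: "real (card U) - ?er \<le> (\<Sum>i\<in>U. d j i)" if "j \<in> V" for j
  proof -
    have jN: "j \<in> N" using that V by auto
    have "real (card U) - ?er \<le> real (card U) - real (card (nonadj j))"
      using card_nonadj[OF jN] by simp
    also have "\<dots> \<le> real (card (U - nonadj j))"
      using diff_card_le_card_Diff[OF finite_nonadj, of U j] by linarith
    also have "\<dots> = (\<Sum>i\<in>U - nonadj j. d j i)"
    proof -
      have "d j i = 1" if "i \<in> U - nonadj j" for i
        using that \<open>j \<in> V\<close> jN UN by (intro dominated_if_no_arc) (auto simp: U_def T_def)
      then show ?thesis by simp
    qed
    also have "\<dots> \<le> (\<Sum>i\<in>U. d j i)"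
      using finU UN d_bounds(1)[OF jN] by (intro sum_mono2) auto
    finally show ?thesis .
  qed
  \<comment> \<open>Exchanging the order of summation pairs each weight with its reverse, so the
    average out-degree inside \<open>V\<close> is almost half of its size or more.\<close>
  have in_V: "real (card V) * (real (card V) - ?er) \<le> 2 * (\<Sum>j\<in>V. \<Sum>i\<in>V. d j i)"
  proof -
    have "real (card V) - ?er \<le> (\<Sum>i\<in>V. d j i + d i j)" if "j \<in> V" for j
    proof -
      have jN: "j \<in> N" using that V by auto
      have "real (card V) - ?er \<le> real (card V) - real (card (nonadj j))"
        using card_nonadj[OF jN] by simp
      also have "\<dots> \<le> real (card (V - nonadj j))"
        using diff_card_le_card_Diff[OF finite_nonadj, of V j] by linarith
      also have "\<dots> = (\<Sum>i\<in>V - nonadj j. 1)" by simp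
      also have "\<dots> \<le> (\<Sum>i\<in>V - nonadj j. d j i + d i j)"
      proof (intro sum_mono)
        fix i assume "i \<in> V - nonadj j"
        then show "1 \<le> d j i + d i j"
          using V jN d_refl[OF jN] by (cases "i = j") (auto simp: nonadj_def)
      qed
      also have "\<dots> \<le> (\<Sum>i\<in>V. d j i + d i j)"
        using finV V jN d_bounds(1) by (intro sum_mono2 add_nonneg_nonneg) auto
      finally show ?thesis .
    qed
    then have "(\<Sum>j\<in>V. real (card V) - ?er) \<le> (\<Sum>j\<in>V. \<Sum>i\<in>V. d j i + d i j)"
      by (intro sum_mono) auto
    also have "\<dots> = (\<Sum>j\<in>V. \<Sum>i\<in>V. d j i) + (\<Sum>j\<in>V. \<Sum>i\<in>V. d i j)"
      by (simp add: sum.distrib)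
    also have "(\<Sum>j\<in>V. \<Sum>i\<in>V. d i j) = (\<Sum>j\<in>V. \<Sum>i\<in>V. d j i)" by (rule sum.swap)
    finally show ?thesis by simp
  qed
  define D where "D = (\<Sum>i\<in>N. d v i)"
  have "(\<Sum>i\<in>U. d j i) + (\<Sum>i\<in>V. d j i) \<le> D" if "j \<in> V" for j
  proof -
    have jN: "j \<in> N" using that V by auto
    have "(\<Sum>i\<in>U. d j i) + (\<Sum>i\<in>V. d j i) = (\<Sum>i\<in>U \<union> V. d j i)"
      using finU finV UV by (simp add: sum.union_disjoint)
    also have "\<dots> \<le> (\<Sum>i\<in>N. d j i)"
      using UN V d_bounds(1)[OF jN] by (intro sum_mono2) auto
    finally show ?thesis using v(2)[OF jN] by (simp add: D_def)
  qed
  then have "(real (card U) - ?er) + (\<Sum>i\<in>V. d j i) \<le> D" if "j \<in> V" for j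
    using to_U[OF that] that by fastforce
  then have "(\<Sum>j\<in>V. (real (card U) - ?er) + (\<Sum>i\<in>V. d j i)) \<le> (\<Sum>j\<in>V. D)"
    by (intro sum_mono) auto
  then have "real (card V) * (real (card U) - ?er) + (\<Sum>j\<in>V. \<Sum>i\<in>V. d j i) \<le> real (card V) * D"
    by (simp add: sum.distrib)
  then have "real (card V) * (2 * (real (card U) - ?er) + (real (card V) - ?er)) \<le> real (card V) * (2 * D)"
    using in_V by (simp add: algebra_simps)
  moreover have "0 < real (card V)" using finV V by (simp add: card_gt_0_iff)
  ultimately have "2 * (real (card U) - ?er) + (real (card V) - ?er) \<le> 2 * D"
    by (rule mult_left_le_imp_le)
  moreover have "D \<le> 1 + (\<Sum>a\<in>T. out v a) + real (card U)"
  proof -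
    have "D = d v v + (\<Sum>i\<in>N - {v}. d v i)" unfolding D_def using v(1) by (simp add: sum.remove)
    also have "(\<Sum>i\<in>N - {v}. d v i) = (\<Sum>i\<in>N - {v}. out v i)" by (simp add: out_def)
    also have "\<dots> = (\<Sum>i\<in>outs v. out v i)"
      using out_bounds(1)[OF v(1)] by (intro sum.mono_neutral_right) (force simp: outs_def out_def)+
    also have "\<dots> = (\<Sum>i\<in>T. out v i) + (\<Sum>i\<in>U. out v i)"
      unfolding U_def using finite_outs by (subst sum.subset_diff[of T]) (auto simp: T_def)
    also have "(\<Sum>i\<in>U. out v i) \<le> (\<Sum>i\<in>U. 1)"
      using UN out_bounds(2)[OF v(1)] by (intro sum_mono) auto
    finally show ?thesis using d_refl[OF v(1)] by simp
  qed
  \<comment> \<open>The summand 1 is the loop at \<open>v\<close>; it is absorbed into the error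
    because \<open>\<epsilon> * real r\<close> is at least 1.\<close>
  ultimately show ?thesis using r_large eps_pos unfolding T_def by simp
qed

end

context eps_digraph
begin

lemma costlyD:
  assumes "costly v \<rho> \<mu> C" "x \<in> outs v" "y \<in> N" "z \<in> N" "u \<in> N" "w \<in> N"
    "arc x y" "arc z x" "arc z u" "arc w z"
  shows "C < wx * (\<rho> x + \<mu> x) + wy * \<rho> y + wz * \<rho> z + wu * \<rho> u + ww * \<rho> w"
  using assms outsD[OF assms(2)] unfolding costly_def by blast

lemma weights_le1: "wx + wy \<le> 1" "bwd \<le> 1" "fwd \<le> 1" "0 \<le> bwd" "0 \<le> fwd" "wy \<le> fwd"
  using weights_nonneg weights_sum by (auto simp: bwd_def fwd_def)

lemma fwd_bwd: "1 - \<gamma> \<le> fwd + bwd"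
  using weights_nonneg weights_sum wx_le by (simp add: bwd_def fwd_def)

lemma half_bounds: "0 \<le> half" "half \<le> 1/2" "(1 - \<gamma>) / (1 + \<gamma>) = half / (1 - half)"
  using gamma_nonneg gamma_le by (auto simp: half_def field_simps)

end

section \<open>Lower bounds on the budget when every homomorphism is expensive\<close>

locale costly_prices = eps_digraph +
  fixes v :: nat and \<rho> \<mu> :: "nat \<Rightarrow> real" and C :: real
  assumes v: "v \<in> N" and nonneg: "\<And>j. j \<in> N \<Longrightarrow> 0 \<le> \<rho> j" "\<And>j. j \<in> N \<Longrightarrow> 0 \<le> \<mu> j"
    and costly: "costly v \<rho> \<mu> C"
begin

definition "g a = \<rho> a + \<mu> a"

text \<open>
  All loads on the out-part of \<open>a\<close> are charged \<open>g a\<close>, although only the load of \<open>x\<close> pays \<open>\<mu> a\<close>. The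
  budget is still respected, and constraint (3) no longer needs separate treatment.
\<close>
definition "spread = (\<Sum>j\<in>N. out v j * g j + (1 - out v j) * \<rho> j)"

lemma rho_le_g: "a \<in> N \<Longrightarrow> \<rho> a \<le> g a" using nonneg by (simp add: g_def)

lemma outs_N: "a \<in> outs v \<Longrightarrow> a \<in> N" by (simp add: outs_def)

lemma const_cost: "a \<in> outs v \<Longrightarrow> C < g a"
proof -
  assume a: "a \<in> outs v"
  then have N: "a \<in> N" by (rule outs_N)
  have "C < wx * g a + (wy + wz + wu + ww) * \<rho> a"
    using costlyD[OF costly a N N N N] arc_refl[OF N] by (simp add: g_def algebra_simps)
  also have "\<dots> \<le> wx * g a + (wy + wz + wu + ww) * g a"
    using rho_le_g[OF N] weights_nonneg by (intro add_left_mono mult_left_mono) auto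
  also have "\<dots> = (wx + wy + wz + wu + ww) * g a" by (simp add: algebra_simps)
  finally show "C < g a" by (simp add: weights_sum)
qed

lemma fwd_cost:
  assumes a: "a \<in> outs v" and b: "b \<in> N" "arc a b"
  shows "C < (1 - fwd) * g a + fwd * \<rho> b"
proof -
  have N: "a \<in> N" using a by (rule outs_N)
  have "C < wx * g a + (wz + ww) * \<rho> a + fwd * \<rho> b"
    using costlyD[OF costly a b(1) N b(1) N] arc_refl[OF N] b by (simp add: g_def fwd_def algebra_simps)
  also have "\<dots> \<le> wx * g a + (wz + ww) * g a + fwd * \<rho> b"
    using rho_le_g[OF N] weights_nonneg weights_le1 by (intro add_mono mult_left_mono) auto
  also have "\<dots> = (wx + wz + ww) * g a + fwd * \<rho> b" by (simp add: algebra_simps)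
  also have "wx + wz + ww = 1 - fwd" using weights_sum by (simp add: fwd_def)
  finally show ?thesis .
qed

text \<open>Only \<open>y\<close> moves to \<open>b\<close>; \<open>x\<close>, \<open>z\<close>,
  \<open>u\<close> and \<open>w\<close> stay at \<open>a\<close>.\<close>

lemma leaf_cost:
  assumes a: "a \<in> outs v" and b: "b \<in> N" "arc a b"
  shows "C < (1 - wy) * g a + wy * \<rho> b"
proof -
  have N: "a \<in> N" using a by (rule outs_N)
  have "C < wx * g a + (wz + wu + ww) * \<rho> a + wy * \<rho> b"
    using costlyD[OF costly a b(1) N N N] arc_refl[OF N] b by (simp add: g_def algebra_simps)
  also have "\<dots> \<le> wx * g a + (wz + wu + ww) * g a + wy * \<rho> b"
    using rho_le_g[OF N] weights_nonneg by (intro add_mono mult_left_mono) auto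
  also have "\<dots> = (wx + wz + wu + ww) * g a + wy * \<rho> b" by (simp add: algebra_simps)
  also have "wx + wz + wu + ww = 1 - wy" using weights_sum by simp
  finally show ?thesis .
qed

text \<open>\<open>w\<close>, \<open>z\<close> and \<open>u\<close> sit at \<open>b\<close>,
  \<open>x\<close> at \<open>a\<close>, and the leaf \<open>y\<close> at \<open>b'\<close>. Keeping
  \<open>b'\<close> separate from \<open>a\<close> allows \<open>y\<close> to be parked at the
  cheapest vertex.\<close>

lemma bwd_leaf_cost:
  assumes a: "a \<in> outs v" and b: "b \<in> N" "arc b a" and b': "b' \<in> N" "arc a b'"
  shows "C < wx * g a + bwd * \<rho> b + wy * \<rho> b'"
  using costlyD[OF costly a b'(1) b(1) b(1) b(1)] arc_refl[OF b(1)] b b'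
  by (simp add: g_def bwd_def algebra_simps)

lemma bwd_cost:
  assumes a: "a \<in> outs v" and b: "b \<in> N" "arc b a"
  shows "C < (1 - bwd) * g a + bwd * \<rho> b"
proof -
  have N: "a \<in> N" using a by (rule outs_N)
  have "C < wx * g a + bwd * \<rho> b + wy * \<rho> a"
    using bwd_leaf_cost[OF a b N arc_refl[OF N]] .
  also have "\<dots> \<le> wx * g a + bwd * \<rho> b + wy * g a"
    using rho_le_g[OF N] weights_nonneg by (intro add_left_mono mult_left_mono) auto
  finally show ?thesis by (simp add: bwd_eq algebra_simps)
qed

text \<open>Measured against a reference price \<open>D\<close>, the spread gains the surplus of the
  out-parts and loses the deficit of the in-parts. The later bounds show that the surplus covers
  enough of the deficit.\<close>

lemma spread_eq:
  "spread = real r * D + (\<Sum>j\<in>N. out v j * (g j - D)) - (\<Sum>j\<in>N. (1 - out v j) * (D - \<rho> j))"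
proof -
  have "spread = (\<Sum>j\<in>N. D + out v j * (g j - D) - (1 - out v j) * (D - \<rho> j))"
    unfolding spread_def by (intro sum.cong) (auto simp: algebra_simps)
  then show ?thesis by (simp add: sum.distrib sum_subtractf)
qed

definition "j0 = (SOME j. j \<in> N \<and> (\<forall>i\<in>N. \<rho> j \<le> \<rho> i))"

lemma j0: "j0 \<in> N" "\<And>i. i \<in> N \<Longrightarrow> \<rho> j0 \<le> \<rho> i"
proof -
  have "finite (\<rho> ` N)" "\<rho> ` N \<noteq> {}" using r_pos by auto
  from Min_in[OF this] obtain j where "j \<in> N" "\<rho> j = Min (\<rho> ` N)" by auto
  then have "\<exists>j. j \<in> N \<and> (\<forall>i\<in>N. \<rho> j \<le> \<rho> i)" by (auto intro!: exI[of _ j])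
  from someI_ex[OF this] show "j0 \<in> N" "\<And>i. i \<in> N \<Longrightarrow> \<rho> j0 \<le> \<rho> i"
    by (auto simp: j0_def)
qed

lemma spread_ge_if_min_ge:
  assumes "C \<le> \<rho> j0"
  shows "real r * C \<le> spread"
proof -
  have "(\<Sum>j\<in>N. C) \<le> spread"
    unfolding spread_def
  proof (rule sum_mono)
    fix j assume j: "j \<in> N"
    have C: "C \<le> \<rho> j" using assms j0(2)[OF j] by simp
    have "C = out v j * C + (1 - out v j) * C" by (simp add: algebra_simps)
    also have "\<dots> \<le> out v j * g j + (1 - out v j) * \<rho> j"
      using C rho_le_g[OF j] out_bounds[OF v j] by (intro add_mono mult_left_mono) auto
    finally show "C \<le> out v j * g j + (1 - out v j) * \<rho> j" .
  qed
  then show ?thesis by simp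
qed

lemma sum_in_le:
  assumes "0 \<le> D - \<rho> j0"
  shows "(\<Sum>j\<in>N. (1 - out v j) * (D - \<rho> j)) \<le> (real r - (\<Sum>j\<in>N. out v j)) * (D - \<rho> j0)"
proof -
  have "(\<Sum>j\<in>N. (1 - out v j) * (D - \<rho> j)) \<le> (\<Sum>j\<in>N. (1 - out v j) * (D - \<rho> j0))"
    using out_bounds(2)[OF v] j0(2) by (intro sum_mono mult_left_mono) auto
  also have "\<dots> = (real r - (\<Sum>j\<in>N. out v j)) * (D - \<rho> j0)"
    by (simp add: sum_distrib_right[symmetric] sum_subtractf)
  finally show ?thesis .
qed

text \<open>Whichever way the arc between \<open>a\<close> and \<open>j0\<close> points, a fold onto
  it forces a surplus of at least \<open>k * m0\<close> at \<open>a\<close>, where \<open>k\<close>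
  is \<open>half / (1 - half)\<close>. The in-parts lose at most \<open>m0\<close> per unit of mass
  and have at most about half of the total mass. The net loss is thus about
  \<open>(1 - k) / 2 * real r * m0\<close>, which equals
  \<open>\<gamma> / (1 + \<gamma>) * real r * m0\<close>, and \<open>m0\<close> is at most
  \<open>C\<close>.\<close>

lemma spread_ge_balanced:
  assumes C: "0 \<le> C" and Q: "real r / 2 - 3 * (\<epsilon> * real r) \<le> (\<Sum>j\<in>N. out v j)"
    and h: "half \<le> fwd" "half \<le> bwd"
  shows "real r * C / (1 + \<gamma>) - 20 * (\<epsilon> * real r) * C \<le> spread"
proof (cases "C \<le> \<rho> j0")
  case True
  have "real r * C / (1 + \<gamma>) \<le> real r * C" using C gamma_nonneg by (simp add: field_simps)
  moreover have "0 \<le> 20 * (\<epsilon> * real r) * C" using C eps_pos by simp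
  ultimately show ?thesis using spread_ge_if_min_ge[OF True] by linarith
next
  case False
  define m0 where "m0 = C - \<rho> j0"
  define k where "k = (1 - \<gamma>) / (1 + \<gamma>)"
  define Q where "Q = (\<Sum>j\<in>N. out v j)"
  let ?er = "\<epsilon> * real r"
  have m0: "0 < m0" "m0 \<le> C" using False nonneg(1)[OF j0(1)] by (auto simp: m0_def)
  have k: "0 \<le> k" "k \<le> 1" "1 - k = 2 * \<gamma> / (1 + \<gamma>)"
    using gamma_nonneg gamma_le by (auto simp: k_def field_simps)
  have low: "k * m0 \<le> g a - C" if a: "a \<in> outs v" "a \<notin> nonadj j0" for a
  proof -
    have gC: "0 < g a - C" using const_cost[OF a(1)] by simp
    have key: "half * m0 \<le> (1 - half) * (g a - C)" if "t * m0 \<le> (1 - t) * (g a - C)" "half \<le> t" for t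
    proof -
      have "half * m0 \<le> t * m0" using that(2) m0 by simp
      also have "\<dots> \<le> (1 - t) * (g a - C)" by (rule that(1))
      also have "\<dots> \<le> (1 - half) * (g a - C)" using that(2) gC by simp
      finally show ?thesis .
    qed
    have "half * m0 \<le> (1 - half) * (g a - C)"
    proof (cases "arc a j0")
      case True
      show ?thesis
        by (rule key[OF _ h(1)]) (use fwd_cost[OF a(1) j0(1) True] in \<open>simp add: m0_def algebra_simps\<close>)
    next
      case False
      then have "arc j0 a" using adjacent[OF outs_N[OF a(1)] j0(1) a(2)] by blast
      then show ?thesis
        by (intro key[OF _ h(2)]) (use bwd_cost[OF a(1) j0(1)] in \<open>simp add: m0_def algebra_simps\<close>)
    qed
    then show ?thesis unfolding k_def half_bounds(3) using half_bounds(2) by (simp add: field_simps)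
  qed
  have "k * m0 * (Q - ?er) \<le> k * m0 * (\<Sum>j\<in>N - nonadj j0. out v j)"
    unfolding Q_def using sum_out_diff[OF v finite_nonadj card_nonadj[OF j0(1)]] k m0
    by (intro mult_left_mono) auto
  also have "\<dots> = (\<Sum>j\<in>N - nonadj j0. out v j * (k * m0))"
    by (simp add: sum_distrib_left mult.commute)
  also have "\<dots> = (\<Sum>j\<in>outs v - nonadj j0. out v j * (k * m0))"
    using out_bounds(1)[OF v] by (intro sum.mono_neutral_right) (force simp: outs_def)+
  also have "\<dots> \<le> (\<Sum>j\<in>outs v - nonadj j0. out v j * (g j - C))"
    using low out_bounds(1)[OF v] outs_N by (intro sum_mono mult_left_mono) auto
  also have "\<dots> \<le> (\<Sum>j\<in>outs v. out v j * (g j - C))"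
    using finite_outs const_cost out_bounds(1)[OF v] outs_N
    by (intro sum_mono2 mult_nonneg_nonneg) (auto simp: less_imp_le)
  finally have X: "k * m0 * (Q - ?er) \<le> (\<Sum>j\<in>N. out v j * (g j - C))"
    by (simp add: sum_out_outs[OF v])
  have W: "(\<Sum>j\<in>N. (1 - out v j) * (C - \<rho> j)) \<le> (real r - Q) * m0"
    using sum_in_le[of C] False by (simp add: Q_def m0_def)
  have "(\<gamma> / (1 + \<gamma>)) * real r + 7 * ?er \<ge> (real r - Q) - k * (Q - ?er)"
  proof -
    have "(real r - Q) - k * (Q - ?er) = real r - Q * (1 + k) + k * ?er" by (simp add: algebra_simps)
    also have "\<dots> \<le> real r - (real r / 2 - 3 * ?er) * (1 + k) + 1 * ?er"
      using assms(2) k eps_pos unfolding Q_def[symmetric]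
      by (intro add_mono diff_left_mono mult_right_mono) auto
    also have "\<dots> = (1 - k) / 2 * real r + (4 + 3 * k) * ?er" by (simp add: field_simps)
    also have "\<dots> \<le> (1 - k) / 2 * real r + 7 * ?er" using k eps_pos by (intro add_left_mono mult_right_mono) auto
    also have "(1 - k) / 2 = \<gamma> / (1 + \<gamma>)" using gamma_nonneg by (simp only: k(3)) (simp add: field_simps)
    finally show ?thesis .
  qed
  then have "((real r - Q) - k * (Q - ?er)) * m0 \<le> ((\<gamma> / (1 + \<gamma>)) * real r + 7 * ?er) * m0"
    using m0 by (intro mult_right_mono) auto
  also have "\<dots> \<le> ((\<gamma> / (1 + \<gamma>)) * real r + 7 * ?er) * C"
    using m0 gamma_nonneg eps_pos by (intro mult_left_mono) auto
  finally have "real r * C - ((\<gamma> / (1 + \<gamma>)) * real r + 7 * ?er) * C \<le> spread"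
    using X W spread_eq[of C] by (simp add: algebra_simps)
  moreover have "real r * C - ((\<gamma> / (1 + \<gamma>)) * real r + 7 * ?er) * C
      = real r * C / (1 + \<gamma>) - 7 * ?er * C"
    using gamma_nonneg by (simp add: field_simps)
  moreover have "7 * ?er * C \<le> 20 * ?er * C" using eps_pos C by (intro mult_right_mono) auto
  ultimately show ?thesis by linarith
qed

text \<open>Arcs from \<open>a\<close> to a cheap \<open>j\<close> force the large rate
  \<open>ks\<close>, but arcs from \<open>j0\<close> to \<open>a\<close> only the small rate
  \<open>ke\<close>. Since \<open>v\<close> has maximal out-degree, every set meets in-neighbours of
  at least about half its size in the out-part. So the deficit is matched at the mean of the two
  rates, which is at least \<open>k\<close> by convexity.\<close>

lemma spread_ge_forward:
  assumes C: "0 \<le> C" and vmax: "\<And>j. j \<in> N \<Longrightarrow> (\<Sum>i\<in>N. d j i) \<le> (\<Sum>i\<in>N. d v i)"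
    and Q: "real r / 2 - 3 * (\<epsilon> * real r) \<le> (\<Sum>j\<in>N. out v j)"
    and h: "bwd < half"
  shows "real r * C / (1 + \<gamma>) - 20 * (\<epsilon> * real r) * C \<le> spread"
proof (cases "C \<le> \<rho> j0")
  case True
  have "real r * C / (1 + \<gamma>) \<le> real r * C" using C gamma_nonneg by (simp add: field_simps)
  moreover have "0 \<le> 20 * (\<epsilon> * real r) * C" using C eps_pos by simp
  ultimately show ?thesis using spread_ge_if_min_ge[OF True] by linarith
next
  case False
  define m where "m j = C - \<rho> j" for j
  define m0 where "m0 = m j0"
  define k where "k = (1 - \<gamma>) / (1 + \<gamma>)"
  define ke where "ke = bwd / (1 - bwd)"
  \<comment> \<open>The cap 2 is the value of \<open>fwd / (1 - fwd)\<close> at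
    \<open>2 / 3\<close>. It keeps the error terms bounded, and \<open>2 * k \<le> ks + ke\<close>
    survives because \<open>k\<close> is at most 1.\<close>
  define ks where "ks = (if fwd \<le> 2 / 3 then fwd / (1 - fwd) else 2)"
  define Q where "Q = (\<Sum>j\<in>N. out v j)"
  define X where "X = (\<Sum>j\<in>N. out v j * (g j - C))"
  define W where "W = (\<Sum>j\<in>N. (1 - out v j) * m j)"
  let ?er = "\<epsilon> * real r"
  have er: "0 \<le> ?er" using eps_pos by simp
  have m0: "0 < m0" "m0 \<le> C" using False nonneg(1)[OF j0(1)] by (auto simp: m0_def m_def)
  have m_le: "m j \<le> m0" if "j \<in> N" for j using j0(2)[OF that] by (simp add: m0_def m_def)
  have fs: "half < fwd" using fwd_bwd h by (simp add: half_def)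
  have bwd1: "bwd < 1/2" using h half_bounds by linarith
  have ke: "0 \<le> ke" "ke \<le> 1" using bwd1 weights_le1 by (auto simp: ke_def field_simps)
  have ks: "0 \<le> ks" "ks \<le> 2" "ks * (1 - fwd) \<le> fwd"
    using weights_le1 fs half_bounds by (auto simp: ks_def field_simps)
  have keks: "ke \<le> ks" and kk: "2 * k \<le> ks + ke"
  proof -
    have "2 * k \<le> ks + ke \<and> ke \<le> ks"
    proof (cases "fwd \<le> 2/3")
      case True
      have "2 * k \<le> fwd / (1 - fwd) + ke"
        unfolding k_def ke_def half_bounds(3) using True bwd1 half_bounds(2) fwd_bwd
        by (intro odds_convex) (auto simp: half_def)
      moreover have "ke \<le> fwd / (1 - fwd)"
        unfolding ke_def using True bwd1 fs h weights_le1 by (intro frac_le) auto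
      ultimately show ?thesis using True by (simp add: ks_def)
    next
      case False
      have "k \<le> 1" using gamma_nonneg by (simp add: k_def field_simps)
      then show ?thesis using ke False by (simp add: ks_def)
    qed
    then show "ke \<le> ks" "2 * k \<le> ks + ke" by auto
  qed
  have k: "1 - k = 2 * \<gamma> / (1 + \<gamma>)" "k \<le> 1" "0 \<le> k"
    using gamma_nonneg gamma_le by (auto simp: k_def field_simps)
  have gC: "0 < g a - C" if "a \<in> outs v" for a using const_cost[OF that] by simp
  have fw: "ks * m j \<le> g a - C" if "a \<in> outs v" "j \<in> N" "arc a j" for a j
  proof (cases "m j \<le> 0")
    case True
    then show ?thesis using ks(1) gC[OF that(1)] by (meson less_imp_le mult_nonneg_nonpos order_trans)
  next
    case False
    have "fwd * m j < (1 - fwd) * (g a - C)"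
      using fwd_cost[OF that] by (simp add: m_def algebra_simps)
    moreover have "ks * (1 - fwd) * m j \<le> fwd * m j" using ks(3) False by (intro mult_right_mono) auto
    ultimately have less: "(1 - fwd) * (ks * m j) < (1 - fwd) * (g a - C)" by (simp add: algebra_simps)
    then show ?thesis using weights_le1(3) by (simp add: mult_less_cancel_left)
  qed
  have low: "ke * m0 \<le> g a - C" if a: "a \<in> outs v" "a \<notin> nonadj j0" for a
  proof (cases "arc a j0")
    case True
    have "ke * m0 \<le> ks * m0" using keks m0 by simp
    then show ?thesis using fw[OF a(1) j0(1) True] by (simp add: m0_def)
  next
    case False
    then have "arc j0 a" using adjacent[OF outs_N[OF a(1)] j0(1) a(2)] by blast
    from bwd_cost[OF a(1) j0(1) this] have "bwd * m0 < (1 - bwd) * (g a - C)"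
      by (simp add: m0_def m_def algebra_simps)
    then show ?thesis using bwd1 by (simp add: ke_def field_simps)
  qed
  \<comment> \<open>Neighbours of \<open>j0\<close> in the out-part already pay
    \<open>ke * m0\<close>, so only what exceeds this base has to be matched by the Hall-type
    argument.\<close>
  define f where "f j = max 0 (ks * m j - ke * m0)" for j
  define G where "G a = g a - C - (if a \<in> nonadj j0 then 0 else ke * m0)" for a
  have "(\<Sum>j\<in>N. 1/2 * f j) \<le> 3 * ?er * (ks * m0) + (\<Sum>a\<in>outs v. out v a * G a)"
  proof (rule layer_cake_hall[where R = "\<lambda>j a. arc a j" and \<kappa> = 1])
    show "f j \<le> ks * m0" if "j \<in> N" for j
    proof -
      have "ks * m j \<le> ks * m0" using m_le[OF that] ks by (intro mult_left_mono)
      moreover have "0 \<le> ke * m0" "0 \<le> ks * m0" using ke ks m0 by auto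
      ultimately show ?thesis unfolding f_def by linarith
    qed
    show "0 \<le> ks * m0" using ks m0 by simp
    show "0 \<le> G a" if "a \<in> outs v" for a using gC[OF that] low[OF that] by (auto simp: G_def)
    show "1 * f j \<le> G a" if "j \<in> N" "a \<in> outs v" "arc a j" for j a
    proof -
      have "0 \<le> ke * m0" using ke m0 by simp
      then show ?thesis using fw[OF that(2,1,3)] gC[OF that(2)] low[OF that(2)]
        by (auto simp: G_def f_def)
    qed
    show "(\<Sum>j\<in>V. 1/2) \<le> 3 * ?er + 1 * (\<Sum>a | a \<in> outs v \<and> (\<exists>j\<in>V. arc a j). out v a)"
      if "V \<subseteq> N" "V \<noteq> {}" for V
      using in_neighbourhood_of_max_outdegree[OF v vmax that] by simp
  qed (use er finite_outs out_bounds[OF v] outs_N in \<open>auto simp: f_def\<close>)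
  moreover have "(\<Sum>a\<in>outs v. out v a * G a) \<le> X - ke * m0 * (Q - ?er)"
  proof -
    have "(\<Sum>a\<in>outs v. out v a * G a) = (\<Sum>a\<in>N. out v a * (g a - C))
        - (\<Sum>a\<in>N. out v a * (if a \<in> nonadj j0 then 0 else ke * m0))"
      unfolding sum_out_outs[OF v] G_def by (simp add: sum_subtractf right_diff_distrib)
    also have "(\<Sum>a\<in>N. out v a * (if a \<in> nonadj j0 then 0 else ke * m0))
        = (\<Sum>a\<in>N. if a \<notin> nonadj j0 then out v a * (ke * m0) else 0)"
      by (intro sum.cong) auto
    also have "\<dots> = (\<Sum>a\<in>N - nonadj j0. out v a * (ke * m0))"
      by (subst sum.inter_filter[symmetric]) (auto intro!: sum.cong)
    also have "\<dots> = ke * m0 * (\<Sum>a\<in>N - nonadj j0. out v a)"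
      by (simp add: sum_distrib_left mult.commute)
    finally show ?thesis
      using mult_left_mono[OF sum_out_diff[OF v finite_nonadj card_nonadj[OF j0(1)]], of "ke * m0"] ke m0
      by (simp add: X_def Q_def)
  qed
  moreover have "ks * W - ke * m0 * (real r - Q) \<le> (\<Sum>j\<in>N. f j)"
  proof -
    have "ks * W - ke * m0 * (real r - Q) = (\<Sum>j\<in>N. (1 - out v j) * (ks * m j - ke * m0))"
      unfolding W_def Q_def
      by (simp add: right_diff_distrib sum_subtractf sum_distrib_left[symmetric] sum_distrib_right[symmetric])
        (simp add: sum_distrib_left sum_distrib_right algebra_simps sum.distrib sum_subtractf)
    also have "\<dots> \<le> (\<Sum>j\<in>N. f j)"
    proof (rule sum_mono)
      fix j assume j: "j \<in> N"
      have "(1 - out v j) * (ks * m j - ke * m0) \<le> (1 - out v j) * f j"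
        using out_bounds(2)[OF v j] by (intro mult_left_mono) (auto simp: f_def)
      also have "\<dots> \<le> 1 * f j" using out_bounds(1)[OF v j] by (intro mult_right_mono) (auto simp: f_def)
      finally show "(1 - out v j) * (ks * m j - ke * m0) \<le> f j" by simp
    qed
    finally show ?thesis .
  qed
  ultimately have "1/2 * (ks * W - ke * m0 * (real r - Q)) \<le> 3 * ?er * (ks * m0) + (X - ke * m0 * (Q - ?er))"
    unfolding sum_distrib_left[symmetric] by (elim order_trans[OF mult_left_mono order_trans[OF _ add_left_mono]]) simp
  moreover have "3 * ?er * (ks * m0) \<le> 3 * ?er * (2 * m0)"
    using er ks m0 by (intro mult_left_mono mult_right_mono) auto
  moreover have "ke * (m0 * ?er) \<le> 1 * (m0 * ?er)" using ke m0 er by (intro mult_right_mono) auto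
  moreover have "ke * (m0 * (real r - 2 * Q)) \<le> 6 * (m0 * ?er)"
  proof -
    have "ke * (m0 * (real r - 2 * Q)) \<le> ke * (m0 * (6 * ?er))"
      using ke m0 assms(3) unfolding Q_def[symmetric] by (intro mult_left_mono) auto
    also have "\<dots> \<le> 1 * (m0 * (6 * ?er))" using ke m0 er by (intro mult_right_mono) auto
    finally show ?thesis by simp
  qed
  ultimately have X: "ks * W / 2 + ke * (m0 * (real r - Q)) / 2 - 13 * (?er * m0) \<le> X"
    by (simp add: field_simps)
  have W: "W \<le> m0 * (real r - Q)"
    using sum_in_le[of C] False by (simp add: Q_def m0_def m_def W_def mult.commute)
  have PQ: "real r - Q \<le> real r / 2 + 3 * ?er" using assms(3) by (simp add: Q_def)
  have "W - X \<le> (\<gamma> / (1 + \<gamma>)) * real r * m0 + 16 * (?er * m0)"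
  proof (cases "W \<le> 0")
    case True
    have "0 \<le> X"
      unfolding X_def sum_out_outs[OF v, symmetric]
      using gC out_bounds(1)[OF v] outs_N by (intro sum_nonneg mult_nonneg_nonneg) (auto simp: less_imp_le)
    moreover have "0 \<le> (\<gamma> / (1 + \<gamma>)) * real r * m0 + 16 * (?er * m0)"
      using gamma_nonneg er m0 by auto
    ultimately show ?thesis using True by linarith
  next
    case False
    \<comment> \<open>The base payment is proportional to \<open>m0 * (real r - Q)\<close>, which is
      at least \<open>W\<close>. It therefore supplies the share \<open>ke / 2\<close> of
      \<open>W\<close>, next to the share \<open>ks / 2\<close> from the matching.\<close>
    have "ke * W \<le> ke * (m0 * (real r - Q))" using W ke by (intro mult_left_mono)
    then have "(ks + ke) / 2 * W - 13 * (?er * m0) \<le> X" using X by (simp add: field_simps)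
    moreover have "k * W \<le> (ks + ke) / 2 * W" using kk False by (intro mult_right_mono) auto
    ultimately have "W - X \<le> (1 - k) * W + 13 * (?er * m0)" by (simp add: algebra_simps)
    also have "(1 - k) * W \<le> (1 - k) * (m0 * (real r / 2 + 3 * ?er))"
      using W PQ m0 k by (intro mult_left_mono order_trans[OF W]) auto
    also have "\<dots> = (1 - k) / 2 * real r * m0 + (1 - k) * (3 * (?er * m0))"
      by (simp add: field_simps)
    also have "(1 - k) / 2 = \<gamma> / (1 + \<gamma>)" using gamma_nonneg by (simp only: k(1)) (simp add: field_simps)
    also have "(1 - k) * (3 * (?er * m0)) \<le> 1 * (3 * (?er * m0))"
      using k er m0 by (intro mult_right_mono) auto
    finally show ?thesis by (simp add: mult_ac)
  qed
  also have "\<dots> = ((\<gamma> / (1 + \<gamma>)) * real r + 16 * ?er) * m0" by (simp add: algebra_simps)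
  also have "\<dots> \<le> ((\<gamma> / (1 + \<gamma>)) * real r + 16 * ?er) * C"
    using m0 gamma_nonneg er by (intro mult_left_mono) auto
  finally have "real r * C - ((\<gamma> / (1 + \<gamma>)) * real r + 16 * ?er) * C \<le> spread"
    using spread_eq[of C] by (simp add: X_def W_def m_def)
  moreover have "real r * C - ((\<gamma> / (1 + \<gamma>)) * real r + 16 * ?er) * C
      = real r * C / (1 + \<gamma>) - 16 * ?er * C"
    using gamma_nonneg by (simp add: field_simps)
  moreover have "16 * ?er * C \<le> 20 * ?er * C" using er C by (intro mult_right_mono) auto
  ultimately show ?thesis by linarith
qed

end

section \<open>The obstruction for small forward weight\<close>

context merged_weights
begin

text \<open>The lower bound \<open>1 / 2\<close> only serves to keep \<open>kap\<close> bounded when \<open>wx + wy\<close> vanishes.\<close>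
definition "xycap = max (wx + wy) (1 / 2)"
text \<open>A rate at which a cheap vertex forces a surplus on its out-neighbours \<open>a\<close>
  in the out-part. It is valid both when \<open>j0\<close> has an arc to \<open>a\<close> and when
  \<open>a\<close> has an arc to \<open>j0\<close>.\<close>

definition "kap = (bwd - wy) / xycap"

lemma kap_bounds:
  assumes "fwd < half"
  shows "0 < kap" "kap \<le> 2" "2 * (half - wy) \<le> bwd - wy" "wy < half" "half \<le> 1/2" "kap * xycap = bwd - wy"
    "1/2 \<le> xycap" "wx + wy \<le> xycap"
proof -
  show y: "wy < half" using assms weights_nonneg by (simp add: fwd_def)
  show h: "half \<le> 1/2" using gamma_nonneg by (simp add: half_def)
  show b: "2 * (half - wy) \<le> bwd - wy" using wx_le by (simp add: bwd_eq half_def)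
  show t: "1/2 \<le> xycap" "wx + wy \<le> xycap" by (auto simp: xycap_def)
  show "0 < kap" unfolding kap_def using b y t by (intro divide_pos_pos) auto
  have "bwd - wy \<le> 2 * xycap" using t weights_nonneg by (simp add: bwd_eq)
  then show "kap \<le> 2" using t by (simp add: kap_def field_simps)
  show "kap * xycap = bwd - wy" using t by (simp add: kap_def)
qed

end

context costly_prices
begin

text \<open>If no such \<open>V\<close> existed, the Hall-type condition would hold with deficiency
  \<open>K\<close>. The deficits would then be covered by the surpluses up to \<open>K * m0\<close>,
  and the spread could not be this small.\<close>

lemma obstruction_if_backward:
  assumes C: "0 \<le> C" and h: "fwd < half" and a: "0 \<le> \<alpha>"
    and small: "spread < real r * C / (1 + \<gamma>) - 2 * (\<alpha> + 3 * \<epsilon>) * real r * C"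
  shows "\<exists>V\<subseteq>N. V \<noteq> {} \<and> (\<gamma> + wy + \<alpha>) * real r / (1 + \<gamma>)
      + kap * (\<Sum>a | a \<in> outs v \<and> (\<exists>j\<in>V. arc j a). out v a) < (\<Sum>j\<in>V. 1 - out v j)"
proof (rule ccontr)
  assume neg: "\<not> ?thesis"
  define K where "K = (\<gamma> + wy + \<alpha>) * real r / (1 + \<gamma>)"
  have hall: "(\<Sum>j\<in>V. 1 - out v j) \<le> K + kap * (\<Sum>a | a \<in> outs v \<and> (\<exists>j\<in>V. arc j a). out v a)"
    if "V \<subseteq> N" "V \<noteq> {}" for V
    using neg that by (auto simp: K_def not_less)
  note kap = kap_bounds[OF h]
  let ?er = "\<epsilon> * real r"
  have er: "0 \<le> ?er" using eps_pos by simp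
  have y1: "1/2 < 1 - wy" "0 \<le> wy" using kap weights_nonneg by linarith+
  have low: "\<rho> j0 < C"
  proof (rule ccontr)
    assume "\<not> \<rho> j0 < C"
    then have "real r * C \<le> spread" by (intro spread_ge_if_min_ge) simp
    moreover have "real r * C / (1 + \<gamma>) \<le> real r * C" using C gamma_nonneg by (simp add: field_simps)
    moreover have "0 \<le> 2 * (\<alpha> + 3 * \<epsilon>) * real r * C" using C eps_pos a by simp
    ultimately show False using small by linarith
  qed
  \<comment> \<open>\<open>C'\<close> is the average price left for the other vertices of the forest
    once \<open>y\<close> is placed at \<open>j0\<close>; surpluses and deficits are measured from
    it.\<close>
  define C' where "C' = (C - wy * \<rho> j0) / (1 - wy)"
  define m where "m j = C' - \<rho> j" for j
  define m0 where "m0 = m j0"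
  have CC: "C = (1 - wy) * C' + wy * \<rho> j0" using y1 by (simp add: C'_def)
  have m0_eq: "(1 - wy) * m0 = C - \<rho> j0" using CC by (simp add: m0_def m_def algebra_simps)
  have m0: "0 < m0"
  proof -
    have "0 < (1 - wy) * m0" using low m0_eq by simp
    then show ?thesis using y1 by (simp add: zero_less_mult_iff)
  qed
  have "1/2 * m0 \<le> (1 - wy) * m0" using y1 m0 by (intro mult_right_mono) auto
  then have m0_le: "m0 \<le> 2 * C" using m0_eq nonneg(1)[OF j0(1)] by linarith
  have m_le: "m j \<le> m0" if "j \<in> N" for j using j0(2)[OF that] by (simp add: m0_def m_def)
  have CC': "C = C' - wy * m0" using CC by (simp add: m0_def m_def algebra_simps)
  have adj: "0 \<le> g a - C' \<and> (\<forall>b\<in>N. arc b a \<longrightarrow> kap * m b \<le> g a - C')"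
    if a: "a \<in> outs v" "a \<notin> nonadj j0" for a
  proof (cases "arc j0 a")
    case True
    have "(bwd - wy) * m0 < (wx + wy) * (g a - C')"
      using bwd_cost[OF a(1) j0(1) True] CC
      by (simp add: bwd_eq m0_def m_def algebra_simps)
    moreover have "0 < (bwd - wy) * m0" using kap m0 by simp
    ultimately have pos: "0 < (wx + wy) * (g a - C')" "kap * xycap * m0 < (wx + wy) * (g a - C')"
      using kap(6) by auto
    from pos(1) have gp: "0 < g a - C'" using weights_nonneg by (simp add: zero_less_mult_iff)
    have "(wx + wy) * (g a - C') \<le> xycap * (g a - C')" using gp kap(8) by (intro mult_right_mono) auto
    then have "xycap * (kap * m0) < xycap * (g a - C')" using pos(2) by (simp add: algebra_simps)
    then have km0: "kap * m0 \<le> g a - C'" using kap(7) by (simp add: mult_less_cancel_left)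
    have "kap * m b \<le> kap * m0" if "b \<in> N" for b using m_le[OF that] kap(1) by simp
    then show ?thesis using gp km0 by force
  next
    case False
    then have aj: "arc a j0" using adjacent[OF outs_N[OF a(1)] j0(1) a(2)] by blast
    have "0 < (1 - wy) * (g a - C')"
      using leaf_cost[OF a(1) j0(1) aj] CC by (simp add: algebra_simps)
    then have gp: "0 < g a - C'" using y1 by (simp add: zero_less_mult_iff)
    have "kap * m b \<le> g a - C'" if b: "b \<in> N" "arc b a" for b
    proof (cases "m b \<le> 0")
      case True
      then have "kap * m b \<le> 0" using kap(1) by (simp add: mult_le_0_iff)
      then show ?thesis using gp by linarith
    next
      case False
      have "bwd * m b < wx * (g a - C')"
        using bwd_leaf_cost[OF a(1) b j0(1) aj] CC by (simp add: bwd_eq m_def algebra_simps)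
      moreover have "kap * xycap * m b \<le> bwd * m b"
        unfolding kap(6) using False y1 by (intro mult_right_mono) auto
      moreover have "wx * (g a - C') \<le> xycap * (g a - C')"
        using gp kap(8) y1 by (intro mult_right_mono) auto
      ultimately have "xycap * (kap * m b) < xycap * (g a - C')" by (simp add: algebra_simps)
      then show ?thesis using kap(7) by (simp add: mult_less_cancel_left)
    qed
    then show ?thesis using gp by simp
  qed
  define f where "f j = max 0 (m j)" for j
  \<comment> \<open>For \<open>a\<close> not adjacent to \<open>j0\<close> only the constant fold is
    available, and it bounds \<open>g a - C'\<close> below by \<open>- m0\<close>. Adding
    \<open>3 * m0\<close> leaves at least \<open>2 * m0\<close>, enough for \<open>kap * f j\<close>
    since \<open>kap\<close> is at most 2.\<close>
  define G where "G a = g a - C' + (if a \<in> nonadj j0 then 3 * m0 else 0)" for a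
  have Gfar: "2 * m0 \<le> G a" if "a \<in> outs v" "a \<in> nonadj j0" for a
  proof -
    have "wy * m0 \<le> 1 * m0" using y1 m0 by (intro mult_right_mono) auto
    then show ?thesis using const_cost[OF that(1)] that(2) CC' by (simp add: G_def)
  qed
  have kapf: "kap * f j \<le> 2 * m0" if "j \<in> N" for j
    using m_le[OF that] m0 kap by (intro mult_mono) (auto simp: f_def)
  have K0: "0 \<le> K" using gamma_nonneg y1 a by (simp add: K_def)
  have LC: "(\<Sum>j\<in>N. (1 - out v j) * f j) \<le> K * m0 + (\<Sum>a\<in>outs v. out v a * G a)"
  proof (rule layer_cake_hall[where R = "\<lambda>j a. arc j a" and \<kappa> = kap])
    show "f j \<le> m0" if "j \<in> N" for j using m_le[OF that] m0 by (simp add: f_def)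
    show "0 \<le> G a" if "a \<in> outs v" for a
      using adj[OF that] Gfar[OF that] m0 by (cases "a \<in> nonadj j0") (auto simp: G_def)
    show "kap * f j \<le> G a" if "j \<in> N" "a \<in> outs v" "arc j a" for j a
      using adj[OF that(2)] Gfar[OF that(2)] kapf[OF that(1)] that
      by (cases "a \<in> nonadj j0") (auto simp: G_def f_def max_def)
  qed (use finite_outs m0 kap(1) K0 out_bounds[OF v] outs_N hall in \<open>auto simp: f_def\<close>)
  have "(\<Sum>a\<in>outs v. out v a * G a) \<le> (\<Sum>a\<in>N. out v a * (g a - C')) + 3 * m0 * ?er"
  proof -
    have "(\<Sum>a\<in>outs v. out v a * G a) = (\<Sum>a\<in>N. out v a * (g a - C'))
        + (\<Sum>a\<in>N. out v a * (if a \<in> nonadj j0 then 3 * m0 else 0))"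
      unfolding sum_out_outs[OF v] G_def by (simp add: sum.distrib distrib_left)
    also have "(\<Sum>a\<in>N. out v a * (if a \<in> nonadj j0 then 3 * m0 else 0))
        \<le> (\<Sum>a\<in>N. if a \<in> nonadj j0 then 3 * m0 else 0)"
      using out_bounds(2)[OF v] m0 by (intro sum_mono) (auto simp: mult_le_cancel_right1)
    also have "\<dots> = (\<Sum>a\<in>N \<inter> nonadj j0. 3 * m0)" by (simp add: sum.If_cases)
    also have "\<dots> = real (card (nonadj j0)) * (3 * m0)"
      by (simp add: nonadj_def Int_absorb1 subset_iff)
    also have "\<dots> \<le> ?er * (3 * m0)" using card_nonadj[OF j0(1)] m0 by (intro mult_right_mono) auto
    finally show ?thesis by (simp add: algebra_simps)
  qed
  moreover have "(\<Sum>j\<in>N. (1 - out v j) * m j) \<le> (\<Sum>j\<in>N. (1 - out v j) * f j)"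
    using out_bounds(2)[OF v] by (intro sum_mono mult_left_mono) (auto simp: f_def)
  ultimately have "real r * C' - (K + 3 * ?er) * m0 \<le> spread"
    using LC spread_eq[of C'] by (simp add: m_def algebra_simps)
  moreover have "real r * C / (1 + \<gamma>) - 2 * (\<alpha> + 3 * \<epsilon>) * real r * C \<le> real r * C' - (K + 3 * ?er) * m0"
  proof -
    \<comment> \<open>The form of \<open>K\<close> is explained here:
      \<open>C' = C + wy * m0\<close> and \<open>m0 \<le> C'\<close> show that a loss of
      \<open>(\<gamma> + wy) / (1 + \<gamma>) * m0\<close> per vertex still leaves
      \<open>C / (1 + \<gamma>)\<close>.\<close>
    have "m0 \<le> C'" using nonneg(1)[OF j0(1)] by (simp add: m0_def m_def)
    then have "\<gamma> * m0 \<le> \<gamma> * C'" using gamma_nonneg by (rule mult_left_mono)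
    then have "C + (\<gamma> + wy) * m0 \<le> (1 + \<gamma>) * C'" using CC' by (simp add: algebra_simps)
    then have "real r * (C + (\<gamma> + wy) * m0) \<le> real r * ((1 + \<gamma>) * C')"
      by (intro mult_left_mono) auto
    then have "real r * (C + (\<gamma> + wy) * m0) / (1 + \<gamma>) \<le> real r * C'"
      using gamma_nonneg by (simp add: pos_divide_le_eq mult_ac)
    moreover have "\<alpha> * real r / (1 + \<gamma>) * m0 \<le> \<alpha> * real r / 1 * (2 * C)"
      using a gamma_nonneg m0 m0_le by (intro mult_mono divide_left_mono) auto
    moreover have "3 * ?er * m0 \<le> 3 * ?er * (2 * C)" using m0_le er by (intro mult_left_mono) auto
    moreover have "real r * C' - (K + 3 * ?er) * m0 = real r * C' - (\<gamma> + wy) * real r / (1 + \<gamma>) * m0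
        - \<alpha> * real r / (1 + \<gamma>) * m0 - 3 * ?er * m0"
      by (simp add: K_def algebra_simps add_divide_distrib)
    moreover have "real r * (C + (\<gamma> + wy) * m0) / (1 + \<gamma>) = real r * C / (1 + \<gamma>) + (\<gamma> + wy) * real r / (1 + \<gamma>) * m0"
      by (simp add: algebra_simps add_divide_distrib)
    ultimately show ?thesis by (simp add: algebra_simps)
  qed
  ultimately show False using small by linarith
qed

end

section \<open>Changing the target vertex\<close>

context merged_weights
begin

text \<open>
  Here \<open>t\<close> is the mass of the out-neighbours of \<open>V\<close>; the inequality is affine in \<open>t\<close>, so it reduces
  to the two extreme values.
\<close>
lemma backward_inequality:
  assumes h: "fwd < half" and t: "0 \<le> t" "kap * t \<le> half - wy"
  shows "(wz + wu) * (1 - \<gamma> - wy - kap * t) \<le> bwd * ((1 + \<gamma>) / 2 - t)"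
    and "1 / 4 \<le> (1 + \<gamma>) / 2 - t"
proof -
  note kap = kap_bounds[OF h]
  define D where "D = wz + wu"
  have D: "0 \<le> D" "D \<le> bwd" "D \<le> (1 + \<gamma>) / 2 - wy"
    using weights_nonneg h wz_le by (auto simp: D_def bwd_def fwd_def half_def field_simps)
  have y: "0 \<le> wy" "0 < half - wy" using weights_nonneg kap by auto
  have e: "2 * half - wy \<le> bwd" "0 \<le> 2 * half - wy" using kap(3) y by (simp_all add: algebra_simps)
  \<comment> \<open>\<open>\<phi>\<close> is the position of \<open>kap * t\<close> between 0 and
    \<open>half - wy\<close>. The facts \<open>I0\<close> and \<open>I1\<close> are the endpoints 0
    and 1, with \<open>t\<close> replaced by its upper bound
    \<open>\<phi> * (xycap / 2)\<close>.\<close>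
  define \<phi> where "\<phi> = kap * t / (half - wy)"
  have \<phi>: "0 \<le> \<phi>" "\<phi> \<le> 1" "kap * t = \<phi> * (half - wy)"
    using t kap y by (auto simp: \<phi>_def)
  have t_le: "t \<le> \<phi> * (xycap / 2)"
  proof -
    have "2 * (half - wy) * t \<le> (bwd - wy) * t" using kap(3) t by (intro mult_right_mono)
    also have "\<dots> = kap * t * xycap" by (simp add: kap(6)[symmetric] mult_ac)
    also have "\<dots> = \<phi> * (half - wy) * xycap" by (simp only: \<phi>(3))
    finally have "(half - wy) * (2 * t) \<le> (half - wy) * (\<phi> * xycap)" by (simp add: algebra_simps)
    then have "2 * t \<le> \<phi> * xycap" using y by (simp add: mult_le_cancel_left)
    then show ?thesis by simp
  qed
  have cap: "1/2 \<le> 1 + \<gamma> - xycap"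
    using gamma_nonneg wx_le kap(4,5) by (auto simp: xycap_def max_def field_simps)
  have "\<phi> * (xycap / 2) \<le> 1 * (xycap / 2)" using \<phi> kap(7) by (intro mult_right_mono) auto
  then show "1 / 4 \<le> (1 + \<gamma>) / 2 - t" using t_le cap by (simp add: field_simps)
  have I0: "D * (2 * half - wy) \<le> bwd * ((1 + \<gamma>) / 2)"
  proof -
    have "D \<le> (1 + \<gamma>) / 2" using D(3) y by (simp add: field_simps)
    then have "D * (2 * half - wy) \<le> ((1 + \<gamma>) / 2) * bwd"
      using e gamma_nonneg by (intro mult_mono) auto
    then show ?thesis by (simp add: mult.commute)
  qed
  have I1: "D * half \<le> bwd * ((1 + \<gamma> - xycap) / 2)"
  proof -
    have "D * (1 - \<gamma>) \<le> bwd * (1 + \<gamma> - xycap)"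
    proof (cases "1 - \<gamma> \<le> 1 + \<gamma> - xycap")
      case True
      then show ?thesis using D gamma_le by (intro mult_mono) auto
    next
      case False
      have D': "D * (1 - \<gamma>) \<le> ((1 + \<gamma>) / 2 - wy) * (1 - \<gamma>)"
        using D gamma_le by (intro mult_right_mono) auto
      have b: "1 - \<gamma> - wy \<le> bwd" using wx_le by (simp add: bwd_eq)
      show ?thesis
      proof (cases "wx + wy \<le> 1/2")
        case True
        then have cap: "xycap = 1/2" by (simp add: xycap_def)
        have g4: "\<gamma> \<le> 1/4" using False cap by simp
        have "((1 + \<gamma>) / 2 - wy) * (1 - \<gamma>) \<le> (1 - \<gamma> - wy) * (1/2 + \<gamma>)"
        proof -
          have "(1 - \<gamma> - wy) * (1/2 + \<gamma>) - ((1 + \<gamma>) / 2 - wy) * (1 - \<gamma>)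
              = (\<gamma> * (1 - \<gamma>) + wy * (1 - 4 * \<gamma>)) / 2" by (simp add: field_simps)
          moreover have "0 \<le> \<gamma> * (1 - \<gamma>) + wy * (1 - 4 * \<gamma>)"
            using g4 gamma_nonneg gamma_le y by (intro add_nonneg_nonneg mult_nonneg_nonneg) auto
          ultimately show ?thesis by simp
        qed
        also have "\<dots> \<le> bwd * (1/2 + \<gamma>)" using b gamma_nonneg by (intro mult_right_mono) auto
        also have "1/2 + \<gamma> = 1 + \<gamma> - xycap" using cap by simp
        finally show ?thesis using D' by (rule order_trans[rotated])
      next
        case 2: False
        then have cap: "1 + \<gamma> - xycap = \<gamma> + bwd" by (simp add: xycap_def bwd_eq)
        have yg: "\<gamma> < wy" using False cap wx_le by (simp add: bwd_eq)
        have hg: "\<gamma> \<le> half" using yg y by simp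
        have "((1 + \<gamma>) / 2 - wy) * (1 - \<gamma>) \<le> (2 * half - wy) * (\<gamma> + (2 * half - wy))"
        proof -
          have "(2 * half - wy) * (\<gamma> + (2 * half - wy)) - ((1 + \<gamma>) / 2 - wy) * (1 - \<gamma>)
              = \<gamma> * (half - wy) + half * (half - \<gamma>) + (half - wy)\<^sup>2"
            by (simp add: half_def power2_eq_square field_simps)
          moreover have "0 \<le> \<gamma> * (half - wy) + half * (half - \<gamma>) + (half - wy)\<^sup>2"
            using gamma_nonneg y hg by (intro add_nonneg_nonneg mult_nonneg_nonneg) auto
          ultimately show ?thesis by linarith
        qed
        also have "\<dots> \<le> bwd * (\<gamma> + bwd)" using e gamma_nonneg by (intro mult_mono) auto
        finally show ?thesis unfolding cap using D' by (rule order_trans[rotated])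
      qed
    qed
    then show ?thesis by (simp add: half_def)
  qed
  have "D * (1 - \<gamma> - wy - kap * t) = (1 - \<phi>) * (D * (2 * half - wy)) + \<phi> * (D * half)"
    unfolding \<phi>(3) by (simp add: half_def field_simps)
  also have "\<dots> \<le> (1 - \<phi>) * (bwd * ((1 + \<gamma>) / 2)) + \<phi> * (bwd * ((1 + \<gamma> - xycap) / 2))"
    using I0 I1 \<phi> by (intro add_mono mult_left_mono) auto
  also have "\<dots> = bwd * ((1 + \<gamma>) / 2 - \<phi> * (xycap / 2))" by (simp add: field_simps)
  also have "\<dots> \<le> bwd * ((1 + \<gamma>) / 2 - t)" using t_le D by (intro mult_left_mono) auto
  finally show "(wz + wu) * (1 - \<gamma> - wy - kap * t) \<le> bwd * ((1 + \<gamma>) / 2 - t)"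
    by (simp add: D_def)
qed

text \<open>\<open>sv\<close> and \<open>sk\<close> stand for rescaled sizes of \<open>V\<close> and
  \<open>K\<close>. The natural rate is \<open>ww / (wz + wu)\<close>, at which a cheap place for
  \<open>w\<close> raises prices on \<open>K\<close>. It is capped at 8, where \<open>sk\<close>
  alone suffices because \<open>9 * (1 / 4 - 6 / 60)\<close> exceeds 1.\<close>

lemma backward_capacity:
  assumes h: "fwd < half" and t: "0 \<le> t" "kap * t \<le> half - wy"
    and e: "0 \<le> e" "54 * e \<le> \<alpha>" "e \<le> 1/60"
    and V: "\<gamma> + wy + \<alpha> + kap * t \<le> sv" and K: "(1 + \<gamma>) / 2 - t - e * 6 \<le> sk"
  obtains \<kappa> where "0 \<le> \<kappa>" "\<kappa> \<le> 8" "\<kappa> * (wz + wu) \<le> ww" "1 - sv \<le> (1 + \<kappa>) * sk"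
proof -
  note ineq = backward_inequality[OF h t]
  have sv: "0 \<le> sv"
    using V e t kap_bounds[OF h] gamma_nonneg weights_nonneg
    by (intro order_trans[OF _ V] add_nonneg_nonneg mult_nonneg_nonneg) auto
  show ?thesis
  proof (cases "8 * (wz + wu) \<le> ww")
    case True
    have "1 - sv \<le> (1 + 8) * sk" using ineq(2) K e sv by (simp add: field_simps)
    then show ?thesis using that[of 8] True by simp
  next
    case False
    then have "0 < 8 * (wz + wu)" by (intro le_less_trans[OF weights_nonneg(5)]) simp
    then have D: "0 < wz + wu" by simp
    define \<kappa> where "\<kappa> = ww / (wz + wu)"
    have \<kappa>: "0 \<le> \<kappa>" "\<kappa> \<le> 8" "\<kappa> * (wz + wu) = ww"
      using D False weights_nonneg by (auto simp: \<kappa>_def field_simps)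
    have "(wz + wu) * (1 + \<kappa>) = bwd" using \<kappa>(3) by (simp add: bwd_def algebra_simps)
    then have "(wz + wu) * (1 - \<gamma> - wy - kap * t) \<le> (wz + wu) * ((1 + \<kappa>) * ((1 + \<gamma>) / 2 - t))"
      using ineq(1) by (metis mult.assoc)
    then have "1 - \<gamma> - wy - kap * t \<le> (1 + \<kappa>) * ((1 + \<gamma>) / 2 - t)"
      using D by (simp add: mult_le_cancel_left)
    moreover have "(1 + \<kappa>) * ((1 + \<gamma>) / 2 - t - e * 6) \<le> (1 + \<kappa>) * sk"
      using K \<kappa> by (intro mult_left_mono) auto
    \<comment> \<open>This is the source of the constant 54 in the hypothesis on
      \<open>e\<close>.\<close>
    moreover have "(1 + \<kappa>) * (e * 6) \<le> 9 * (e * 6)" using \<kappa> e by (intro mult_right_mono) auto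
    ultimately have "1 - sv \<le> (1 + \<kappa>) * sk" using V e by (simp add: algebra_simps)
    then show ?thesis using that[of \<kappa>] \<kappa> by simp
  qed
qed

end

section \<open>A target vertex that dominates the obstruction\<close>

context eps_digraph
begin

text \<open>Almost all of \<open>V\<close> and \<open>O'\<close> receives weight 1 from
  \<open>v\<close>. With \<open>x\<close> and \<open>y\<close> at the vertex \<open>x0\<close> of
  \<open>V'\<close> with least \<open>g\<close>, \<open>z\<close> and \<open>u\<close> can go to any
  vertex of \<open>K\<close> adjacent to \<open>x0\<close>, and \<open>w\<close> to any in-neighbour
  of it. So a cheap vertex of \<open>R\<close> raises the prices of its out-neighbours in
  \<open>K\<close>, and the Hall-type condition compensates the deficits on \<open>R\<close> up to
  \<open>\<psi>\<close>.\<close>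

lemma budget_if_sink:
  assumes sub: "V \<subseteq> N" "K \<subseteq> N" "O' \<subseteq> N" and disj: "V \<inter> K = {}" "O' \<inter> (V \<union> K) = {}"
    and noarc: "\<And>j a. j \<in> V \<Longrightarrow> a \<in> K \<Longrightarrow> \<not> arc j a" "\<And>i. i \<in> O' \<Longrightarrow> \<not> arc i v"
    and vK: "v \<in> K" and R: "R = N - V - K - O'"
    and hall: "\<And>S. S \<subseteq> R \<Longrightarrow> S \<noteq> {} \<Longrightarrow> real (card S) \<le> \<psi> + \<kappa> * real (card {a \<in> K. \<exists>i\<in>S. arc i a})"
    and psi: "0 \<le> \<psi>" "(1 + \<gamma>) * \<psi> \<le> \<gamma> * real r"
    and kappa: "0 \<le> \<kappa>" "\<kappa> \<le> 8" "\<kappa> * (wz + wu) \<le> ww" and bwd: "0 < bwd"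
    and big: "(wx + wy + 20 * \<epsilon>) * real r \<le> (1 + \<gamma>) * real (card V)"
    and nonneg: "\<And>j. j \<in> N \<Longrightarrow> 0 \<le> \<rho> j" "\<And>j. j \<in> N \<Longrightarrow> 0 \<le> \<mu> j"
    and C: "0 \<le> C" and costly: "costly v \<rho> \<mu> C"
  shows "real r * C - 22 * (\<epsilon> * real r) * C \<le> (1 + \<gamma>) * (\<Sum>j\<in>N. \<rho> j + d v j * \<mu> j)"
proof -
  have vN: "v \<in> N" using vK sub by auto
  interpret costly_prices wx wy wz wu ww \<gamma> \<epsilon> r d v \<rho> \<mu> C
    by unfold_locales (use vN nonneg costly in auto)
  let ?er = "\<epsilon> * real r" and ?B = "\<Sum>j\<in>N. \<rho> j + d v j * \<mu> j"
  have er: "0 < ?er" "1 \<le> ?er" using r_large by auto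
  have fin: "finite V" "finite K" "finite O'" using sub finite_subset by blast+
  define V' where "V' = V - nonadj v"
  define O1 where "O1 = O' - nonadj v"
  have dom: "d v j = 1 \<and> j \<in> outs v" if "j \<in> V' \<union> O1" for j
  proof -
    have j: "j \<in> N" "j \<notin> nonadj v" "\<not> arc j v" "j \<noteq> v"
      using that sub disj noarc vK by (auto simp: V'_def O1_def)
    have "d v j = 1" using dominated_if_no_arc[OF j(1) vN j(2,3)] .
    then show ?thesis using j by (simp add: outs_def out_def)
  qed
  have cV': "real (card V) - ?er \<le> real (card V')"
    using diff_card_le_card_Diff[OF finite_nonadj, of V v] card_nonadj[OF vN] unfolding V'_def by linarith
  have cO1: "real (card O') - ?er \<le> real (card O1)"
    using diff_card_le_card_Diff[OF finite_nonadj, of O' v] card_nonadj[OF vN] unfolding O1_def by linarith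
  have V'big: "(wx + wy) * real r \<le> (1 + \<gamma>) * real (card V')" and V'ne: "0 < card V'"
  proof -
    have "(1 + \<gamma>) * (real (card V) - ?er) \<le> (1 + \<gamma>) * real (card V')"
      using cV' gamma_nonneg by (intro mult_left_mono) auto
    moreover have "(1 + \<gamma>) * ?er \<le> 2 * ?er" using gamma_le er by (intro mult_right_mono) auto
    ultimately have *: "(wx + wy) * real r + 18 * ?er \<le> (1 + \<gamma>) * real (card V')"
      using big by (simp add: algebra_simps)
    then show "(wx + wy) * real r \<le> (1 + \<gamma>) * real (card V')" using er by linarith
    have "0 \<le> (wx + wy) * real r" using weights_nonneg by simp
    then have "0 < (1 + \<gamma>) * real (card V')" using * er by linarith
    then show "0 < card V'" by (simp add: zero_less_mult_iff)
  qed
  obtain x0 where x0: "x0 \<in> V'" "\<And>j. j \<in> V' \<Longrightarrow> g x0 \<le> g j"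
  proof -
    have "finite (g ` V')" "g ` V' \<noteq> {}" using V'ne fin by (auto simp: V'_def card_gt_0_iff)
    from Min_in[OF this] obtain x where "x \<in> V'" "g x = Min (g ` V')" by auto
    then show ?thesis using that Min_le[OF \<open>finite (g ` V')\<close>] by auto
  qed
  have x0': "x0 \<in> outs v" "x0 \<in> V" "x0 \<in> N" using x0 dom[of x0] sub by (auto simp: V'_def)
  define g0 where "g0 = g x0"
  have g0C: "C < g0" unfolding g0_def using const_cost[OF x0'(1)] .
  \<comment> \<open>\<open>C2\<close> is the average price left for \<open>z\<close>,
    \<open>u\<close> and \<open>w\<close> once \<open>x\<close> and \<open>y\<close> are charged
    \<open>g0\<close>. If it is not positive, \<open>V'\<close> alone pays the budget.\<close>
  define C2 where "C2 = (C - (wx + wy) * g0) / bwd"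
  have CC: "C = (wx + wy) * g0 + bwd * C2" using bwd by (simp add: C2_def)
  have C2C: "C2 \<le> C"
  proof -
    have "(wx + wy) * C \<le> (wx + wy) * g0" using g0C weights_nonneg by (intro mult_left_mono) auto
    moreover have "bwd * C = C - (wx + wy) * C" by (simp add: bwd_eq algebra_simps)
    ultimately have "bwd * C2 \<le> bwd * C" using CC by linarith
    then show ?thesis using bwd by (simp add: mult_le_cancel_left)
  qed
  have split: "(\<Sum>j\<in>V'. g j) + (\<Sum>j\<in>O1. g j) + (\<Sum>j\<in>K. \<rho> j) + (\<Sum>j\<in>R. \<rho> j) \<le> ?B"
  proof -
    have "(\<Sum>j\<in>V'. g j) = (\<Sum>j\<in>V'. \<rho> j + d v j * \<mu> j)" "(\<Sum>j\<in>O1. g j) = (\<Sum>j\<in>O1. \<rho> j + d v j * \<mu> j)"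
      using dom by (auto intro!: sum.cong simp: g_def)
    moreover have "(\<Sum>j\<in>K. \<rho> j) \<le> (\<Sum>j\<in>K. \<rho> j + d v j * \<mu> j)"
      "(\<Sum>j\<in>R. \<rho> j) \<le> (\<Sum>j\<in>R. \<rho> j + d v j * \<mu> j)"
      using sub R nonneg(2) d_bounds(1)[OF vN] by (auto intro!: sum_mono)
    moreover have "(\<Sum>j\<in>V'. \<rho> j + d v j * \<mu> j) + (\<Sum>j\<in>O1. \<rho> j + d v j * \<mu> j)
        + (\<Sum>j\<in>K. \<rho> j + d v j * \<mu> j) + (\<Sum>j\<in>R. \<rho> j + d v j * \<mu> j)
        = (\<Sum>j\<in>V' \<union> O1 \<union> K \<union> R. \<rho> j + d v j * \<mu> j)"
    proof -
      have "V' \<inter> O1 = {}" "(V' \<union> O1) \<inter> K = {}" "(V' \<union> O1 \<union> K) \<inter> R = {}"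
        using disj R by (auto simp: V'_def O1_def)
      moreover have "finite V'" "finite O1" "finite R" using fin R by (auto simp: V'_def O1_def)
      ultimately show ?thesis using fin by (simp add: sum.union_disjoint)
    qed
    moreover have "\<dots> \<le> ?B"
      using sub R nonneg d_bounds(1)[OF vN]
      by (intro sum_mono2) (auto simp: V'_def O1_def)
    ultimately show ?thesis by linarith
  qed
  have gV': "real (card V') * g0 \<le> (\<Sum>j\<in>V'. g j)"
    using x0(2) sum_mono[of V' "\<lambda>_. g0" g] by (simp add: g0_def)
  have gpos: "0 \<le> g j" if "j \<in> N" for j using nonneg that by (simp add: g_def)
  show ?thesis
  proof (cases "C2 \<le> 0")
    case True
    have "bwd * C2 \<le> 0" using True bwd by (simp add: mult_le_0_iff)
    then have "C \<le> (wx + wy) * g0" using CC by linarith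
    then have "real r * C \<le> real r * ((wx + wy) * g0)" by (intro mult_left_mono) auto
    also have "\<dots> = ((wx + wy) * real r) * g0" by (simp add: algebra_simps)
    also have "\<dots> \<le> ((1 + \<gamma>) * real (card V')) * g0"
      using V'big g0C C by (intro mult_right_mono) auto
    also have "\<dots> = (1 + \<gamma>) * (real (card V') * g0)" by simp
    also have "\<dots> \<le> (1 + \<gamma>) * ?B"
    proof (intro mult_left_mono)
      have "0 \<le> (\<Sum>j\<in>O1. g j)" "0 \<le> (\<Sum>j\<in>K. \<rho> j)" "0 \<le> (\<Sum>j\<in>R. \<rho> j)"
        using gpos nonneg sub R by (auto intro!: sum_nonneg simp: O1_def)
      then show "real (card V') * g0 \<le> ?B" using split gV' by linarith
    qed (use gamma_nonneg in auto)
    finally have "real r * C \<le> (1 + \<gamma>) * ?B" .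
    moreover have "0 \<le> 22 * ?er * C" using er C by simp
    ultimately show ?thesis by linarith
  next
    case False
    define f where "f i = max 0 (C2 - \<rho> i)" for i
    \<comment> \<open>For \<open>a\<close> not adjacent to \<open>x0\<close> nothing is known beyond
      a nonnegative price. Of the added \<open>9 * C2\<close>, one part cancels \<open>- C2\<close>
      and eight cover \<open>\<kappa> * f i\<close>.\<close>
    define G where "G a = \<rho> a - C2 + (if a \<in> nonadj x0 then 9 * C2 else 0)" for a
    have K0: "C2 < \<rho> a \<and> (\<forall>i\<in>N. arc i a \<longrightarrow> \<kappa> * f i \<le> \<rho> a - C2)"
      if a: "a \<in> K" "a \<notin> nonadj x0" for a
    proof -
      have aN: "a \<in> N" using a sub by auto
      have ax: "arc a x0" using adjacent[OF aN x0'(3) a(2)] noarc(1)[OF x0'(2) a(1)] by blast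
      have *: "C < (wx + wy) * g0 + (wz + wu) * \<rho> a + ww * \<rho> i" if i: "i \<in> N" "arc i a" for i
      proof -
        have "C < wx * g0 + wy * \<rho> x0 + wz * \<rho> a + wu * \<rho> a + ww * \<rho> i"
          unfolding g0_def g_def
          by (rule costlyD[OF costly]) (use x0' aN i ax arc_refl in auto)
        moreover have "wy * \<rho> x0 \<le> wy * g0"
          using rho_le_g[OF x0'(3)] weights_nonneg by (intro mult_left_mono) (auto simp: g0_def)
        ultimately show ?thesis by (simp add: algebra_simps)
      qed
      have bwd_sum: "bwd = (wz + wu) + ww" by (simp add: bwd_def)
      have "bwd * C2 < bwd * \<rho> a"
        using *[OF aN arc_refl[OF aN]] CC bwd_sum by (simp add: algebra_simps)
      then have less: "C2 < \<rho> a" using bwd by (simp add: mult_less_cancel_left)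
      have "\<kappa> * f i \<le> \<rho> a - C2" if i: "i \<in> N" "arc i a" for i
      proof (cases "C2 - \<rho> i \<le> 0")
        case True
        then show ?thesis using less by (simp add: f_def)
      next
        case pos: False
        have lt: "ww * (C2 - \<rho> i) < (wz + wu) * (\<rho> a - C2)"
          using *[OF i] CC bwd_sum by (simp add: algebra_simps)
        have "\<kappa> * (wz + wu) * (C2 - \<rho> i) \<le> ww * (C2 - \<rho> i)"
          using kappa(3) pos by (intro mult_right_mono) auto
        then have "(wz + wu) * (\<kappa> * (C2 - \<rho> i)) < (wz + wu) * (\<rho> a - C2)"
          using lt by (simp add: algebra_simps)
        then have "\<kappa> * (C2 - \<rho> i) < \<rho> a - C2"
          using weights_nonneg by (simp add: mult_less_cancel_left)
        then show ?thesis using pos by (simp add: f_def)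
      qed
      then show ?thesis using less by blast
    qed
    have RN: "R \<subseteq> N" "finite R" using R by auto
    have LC: "(\<Sum>i\<in>R. 1 * f i) \<le> \<psi> * C2 + (\<Sum>a\<in>K. 1 * G a)"
    proof (rule layer_cake_hall[where R = arc and \<kappa> = \<kappa>])
      show "f i \<le> C2" if "i \<in> R" for i using that RN nonneg(1)[of i] False by (auto simp: f_def)
      show "0 \<le> G a" if "a \<in> K" for a
        using K0[OF that] False nonneg(1)[of a] that sub by (cases "a \<in> nonadj x0") (auto simp: G_def)
      show "\<kappa> * f i \<le> G a" if "i \<in> R" "a \<in> K" "arc i a" for i a
      proof (cases "a \<in> nonadj x0")
        case True
        have "\<kappa> * f i \<le> 8 * C2"
          using kappa False that RN nonneg(1)[of i] by (intro mult_mono) (auto simp: f_def)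
        moreover have "0 \<le> \<rho> a" using nonneg(1)[of a] that sub by auto
        ultimately show ?thesis using True by (simp add: G_def)
      next
        case False
        then show ?thesis using K0[OF that(2)] that RN by (auto simp: G_def)
      qed
    qed (use RN fin kappa psi False hall in \<open>auto simp: f_def Collect_conj_eq Int_commute\<close>)
    have GK: "(\<Sum>a\<in>K. G a) \<le> (\<Sum>a\<in>K. \<rho> a) - real (card K) * C2 + 9 * ?er * C2"
    proof -
      have "(\<Sum>a\<in>K. G a) = (\<Sum>a\<in>K. \<rho> a) - real (card K) * C2 + (\<Sum>a\<in>K \<inter> nonadj x0. 9 * C2)"
        using fin by (simp add: G_def sum.distrib sum_subtractf sum.If_cases)
      also have "(\<Sum>a\<in>K \<inter> nonadj x0. 9 * C2) \<le> ?er * (9 * C2)"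
      proof -
        have "real (card (K \<inter> nonadj x0)) \<le> real (card (nonadj x0))"
          using finite_nonadj by (simp add: card_mono)
        also have "\<dots> \<le> ?er" by (rule card_nonadj[OF x0'(3)])
        finally show ?thesis using False by (simp add: mult_right_mono)
      qed
      finally show ?thesis by (simp add: algebra_simps)
    qed
    have "real (card R) * C2 - (\<Sum>i\<in>R. f i) = (\<Sum>i\<in>R. C2 - f i)" by (simp add: sum_subtractf)
    also have "\<dots> \<le> (\<Sum>i\<in>R. \<rho> i)" by (intro sum_mono) (auto simp: f_def)
    finally have KR: "(real (card K) + real (card R) - \<psi> - 9 * ?er) * C2 \<le> (\<Sum>a\<in>K. \<rho> a) + (\<Sum>i\<in>R. \<rho> i)"
      using LC GK by (simp add: algebra_simps)
    have "real (card O1) * C2 \<le> (\<Sum>j\<in>O1. g j)"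
    proof -
      have "C2 \<le> g j" if "j \<in> O1" for j using const_cost[of j] dom[of j] that C2C by auto
      then show ?thesis using sum_mono[of O1 "\<lambda>_. C2" g] by simp
    qed
    moreover have "(real (card O') - ?er) * C2 \<le> real (card O1) * C2"
      using cO1 False by (intro mult_right_mono) auto
    ultimately have "real (card V') * g0 + (real (card O') + real (card K) + real (card R) - \<psi> - 10 * ?er) * C2 \<le> ?B"
      using split gV' KR by (simp add: algebra_simps)
    moreover have "real (card O') + real (card K) + real (card R) = real r - real (card V)"
    proof -
      have "N = V \<union> (K \<union> (O' \<union> R))" using R sub by auto
      then have "r = card (V \<union> (K \<union> (O' \<union> R)))" by (metis card_atLeastAtMost diff_Suc_1)
      also have "\<dots> = card V + (card K + (card O' + card R))"
      proof -
        have "V \<inter> (K \<union> (O' \<union> R)) = {}" "K \<inter> (O' \<union> R) = {}" "O' \<inter> R = {}" using disj R by auto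
        then show ?thesis using fin RN by (simp add: card_Un_disjoint)
      qed
      finally show ?thesis by simp
    qed
    ultimately have "real (card V') * g0 + (real r - real (card V) - \<psi> - 10 * ?er) * C2 \<le> ?B" by simp
    then have B: "(1 + \<gamma>) * (real (card V') * g0 + (real r - real (card V) - \<psi> - 10 * ?er) * C2) \<le> (1 + \<gamma>) * ?B"
      using gamma_nonneg by (intro mult_left_mono) auto
    have "real r * C - 22 * ?er * C \<le> real r * C - 22 * ?er * C2"
      using C2C er by (intro diff_left_mono mult_left_mono) auto
    moreover have "real r * C = (wx + wy) * real r * g0 + bwd * real r * C2"
      by (subst CC) (simp add: algebra_simps)
    moreover have "(wx + wy) * real r * g0 + bwd * real r * C2 - 22 * ?er * C2
        \<le> (1 + \<gamma>) * (real (card V') * g0 + (real r - real (card V) - \<psi> - 10 * ?er) * C2)"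
    proof -
      \<comment> \<open>\<open>V'\<close> is larger than the weight of \<open>x\<close> and
        \<open>y\<close> requires, and its excess, priced at \<open>g0\<close>, is worth at least as
        much at the lower price \<open>C2\<close>. Only coefficients of \<open>C2\<close> then
        remain to be compared.\<close>
      have "((1 + \<gamma>) * real (card V') - (wx + wy) * real r) * C2
          \<le> ((1 + \<gamma>) * real (card V') - (wx + wy) * real r) * g0"
        using V'big C2C g0C by (intro mult_left_mono) auto
      moreover have "(1 + \<gamma>) * (real (card V) - ?er) * C2 \<le> (1 + \<gamma>) * real (card V') * C2"
        using cV' gamma_nonneg False by (intro mult_right_mono mult_left_mono) auto
      moreover have "(1 + \<gamma>) * \<psi> * C2 \<le> \<gamma> * real r * C2"
        using psi False by (intro mult_right_mono) auto
      moreover have "(1 + \<gamma>) * (11 * ?er) * C2 \<le> 2 * (11 * ?er) * C2"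
        using gamma_le er False by (intro mult_right_mono) auto
      ultimately show ?thesis by (simp add: bwd_eq algebra_simps)
    qed
    ultimately show ?thesis using B by linarith
  qed
qed

end

context eps_digraph
begin

text \<open>
  The set \<open>O'\<close> maximises the deficiency of the Hall condition from the remaining vertices to \<open>K\<close>.
  Either some vertex of \<open>K\<close> dominates \<open>O'\<close>, whose vertices then become available for \<open>x\<close>, or the
  maximal deficiency is at most the slack \<open>\<gamma> r / (1 + \<gamma>)\<close>.
\<close>
lemma sink_from_obstruction:
  assumes v: "v \<in> N" and Q: "real r / 2 - 3 * (\<epsilon> * real r) \<le> (\<Sum>j\<in>N. out v j)"
    and h: "fwd < half" and a: "60 * \<epsilon> \<le> \<alpha>" "\<alpha> \<le> 1" and V: "V \<subseteq> N"
    and obs: "(\<gamma> + wy + \<alpha>) * real r / (1 + \<gamma>)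
      + kap * (\<Sum>a | a \<in> outs v \<and> (\<exists>j\<in>V. arc j a). out v a) < (\<Sum>j\<in>V. 1 - out v j)"
  shows "\<exists>v\<in>N. \<forall>\<rho> \<mu> C. (\<forall>j\<in>N. 0 \<le> \<rho> j) \<longrightarrow> (\<forall>j\<in>N. 0 \<le> \<mu> j) \<longrightarrow> 0 \<le> C \<longrightarrow> costly v \<rho> \<mu> C \<longrightarrow>
    real r * C - 22 * (\<epsilon> * real r) * C \<le> (1 + \<gamma>) * (\<Sum>j\<in>N. \<rho> j + d v j * \<mu> j)"
proof -
  note kap = kap_bounds[OF h]
  \<comment> \<open>The factor \<open>\<sigma>\<close> rescales counts so that all of
    \<open>N\<close> has size \<open>1 + \<gamma>\<close>, matching the weight inequalities.\<close>
  define \<sigma> where "\<sigma> = (1 + \<gamma>) / real r"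
  define T where "T = {a \<in> outs v. \<exists>j\<in>V. arc j a}"
  define K where "K = outs v - T"
  define q where "q = (\<Sum>a\<in>T. out v a)"
  have r: "0 < real r" using r_pos by simp
  have sg: "0 < \<sigma>" "\<sigma> * real r = 1 + \<gamma>" using r gamma_nonneg by (auto simp: \<sigma>_def)
  have fin: "finite V" "finite K" "finite T" "K \<subseteq> N" "T \<subseteq> N"
    using V finite_subset[OF V] by (auto simp: K_def T_def outs_def)
  have disj: "V \<inter> K = {}" using arc_refl V by (auto simp: K_def T_def outs_def)
  have noarc: "\<not> arc j a" if "j \<in> V" "a \<in> K" for j a using that by (auto simp: K_def T_def)
  have q0: "0 \<le> q" unfolding q_def using fin out_bounds(1)[OF v] by (intro sum_nonneg) auto
  have sumV: "(\<Sum>j\<in>V. 1 - out v j) \<le> real (card V)"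
  proof -
    have "(\<Sum>j\<in>V. 1 - out v j) \<le> (\<Sum>j\<in>V. 1)" using V out_bounds(1)[OF v] by (intro sum_mono) auto
    then show ?thesis by simp
  qed
  have sumV': "(\<Sum>j\<in>V. 1 - out v j) \<le> real r / 2 + 3 * (\<epsilon> * real r)"
  proof -
    have "(\<Sum>j\<in>V. 1 - out v j) \<le> (\<Sum>j\<in>N. 1 - out v j)"
      using V out_bounds(2)[OF v] by (intro sum_mono2) auto
    also have "\<dots> = real r - (\<Sum>j\<in>N. out v j)" by (simp add: sum_subtractf)
    finally show ?thesis using Q by (simp add: field_simps)
  qed
  have obs': "\<gamma> + wy + \<alpha> + kap * (\<sigma> * q) < \<sigma> * (\<Sum>j\<in>V. 1 - out v j)"
  proof -
    have "\<sigma> * ((\<gamma> + wy + \<alpha>) * real r / (1 + \<gamma>) + kap * q) < \<sigma> * (\<Sum>j\<in>V. 1 - out v j)"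
      using obs sg unfolding q_def T_def by (intro mult_strict_left_mono) auto
    moreover have "\<sigma> * ((\<gamma> + wy + \<alpha>) * real r / (1 + \<gamma>)) = \<gamma> + wy + \<alpha>"
      using r gamma_nonneg by (simp add: \<sigma>_def)
    ultimately show ?thesis by (simp add: algebra_simps)
  qed
  have sv: "\<gamma> + wy + \<alpha> + kap * (\<sigma> * q) \<le> \<sigma> * real (card V)"
  proof -
    have "\<sigma> * (\<Sum>j\<in>V. 1 - out v j) \<le> \<sigma> * real (card V)" using sumV sg by (intro mult_left_mono) auto
    then show ?thesis using obs' by linarith
  qed
  have se: "\<sigma> * (3 * (\<epsilon> * real r)) \<le> \<epsilon> * 6"
  proof -
    have "\<sigma> * (3 * (\<epsilon> * real r)) = (\<sigma> * real r) * (3 * \<epsilon>)" by (simp add: mult_ac)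
    also have "\<dots> = (1 + \<gamma>) * (3 * \<epsilon>)" by (simp only: sg(2))
    also have "\<dots> \<le> 2 * (3 * \<epsilon>)" using gamma_le eps_pos by (intro mult_right_mono) auto
    finally show ?thesis by simp
  qed
  have sr: "\<sigma> * (real r / 2) = (1 + \<gamma>) / 2" using sg(2) by simp
  have kt: "kap * (\<sigma> * q) \<le> half - wy"
  proof -
    have "\<sigma> * (\<Sum>j\<in>V. 1 - out v j) \<le> \<sigma> * (real r / 2 + 3 * (\<epsilon> * real r))"
      using sumV' sg by (intro mult_left_mono) auto
    also have "\<dots> \<le> (1 + \<gamma>) / 2 + \<epsilon> * 6" using se sr by (simp only: distrib_left)
    finally have "\<gamma> + wy + \<alpha> + kap * (\<sigma> * q) \<le> (1 + \<gamma>) / 2 + \<epsilon> * 6" using obs' by linarith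
    moreover have "(1 + \<gamma>) / 2 - \<gamma> = half" by (simp add: half_def field_simps)
    ultimately show ?thesis using a eps_pos by linarith
  qed
  have cK: "(\<Sum>j\<in>N. out v j) - q \<le> real (card K)"
  proof -
    have "(\<Sum>j\<in>N. out v j) = (\<Sum>j\<in>outs v. out v j)" using sum_out_outs[OF v, of "\<lambda>_. 1"] by simp
    also have "\<dots> = q + (\<Sum>j\<in>K. out v j)"
      unfolding q_def K_def using finite_outs by (subst sum.subset_diff[of T]) (auto simp: T_def)
    finally have "(\<Sum>j\<in>N. out v j) - q = (\<Sum>j\<in>K. out v j)" by simp
    also have "\<dots> \<le> (\<Sum>j\<in>K. 1)" using fin out_bounds(2)[OF v] by (intro sum_mono) auto
    finally show ?thesis by simp
  qed
  have sk: "(1 + \<gamma>) / 2 - \<sigma> * q - \<epsilon> * 6 \<le> \<sigma> * real (card K)"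
  proof -
    have "\<sigma> * (real r / 2 - 3 * (\<epsilon> * real r) - q) \<le> \<sigma> * real (card K)"
      using cK Q sg by (intro mult_left_mono) auto
    then show ?thesis using se sr by (simp only: right_diff_distrib)
  qed
  have e60: "\<epsilon> \<le> 1/60" "54 * \<epsilon> \<le> \<alpha>" "0 \<le> \<epsilon>" using a eps_pos by auto
  have sq0: "0 \<le> \<sigma> * q" using sg q0 by simp
  obtain \<kappa> where \<kappa>: "0 \<le> \<kappa>" "\<kappa> \<le> 8" "\<kappa> * (wz + wu) \<le> ww"
      "1 - \<sigma> * real (card V) \<le> (1 + \<kappa>) * (\<sigma> * real (card K))"
    by (rule backward_capacity[OF h sq0 kt e60(3,2,1) sv sk])
  have bwd: "0 < bwd" using kap(3,4) weights_nonneg by (simp add: algebra_simps)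
  have big: "(wx + wy + 20 * \<epsilon>) * real r \<le> (1 + \<gamma>) * real (card V)"
  proof -
    have "0 \<le> kap * (\<sigma> * q)" using kap sq0 by simp
    then have "wx + wy + 20 * \<epsilon> \<le> \<sigma> * real (card V)" using sv wx_le a eps_pos by linarith
    then have "(wx + wy + 20 * \<epsilon>) * real r \<le> (\<sigma> * real (card V)) * real r" by (intro mult_right_mono) auto
    also have "\<dots> = (\<sigma> * real r) * real (card V)" by (simp add: mult_ac)
    finally show ?thesis by (simp only: sg(2))
  qed
  have K_ne: "K \<noteq> {}"
  proof
    assume "K = {}"
    then have "(1 + \<gamma>) / 2 - \<sigma> * q \<le> \<epsilon> * 6" using sk by simp
    moreover have "\<epsilon> * 6 < 1/4" using e60 by simp
    ultimately show False using backward_inequality(2)[OF h sq0 kt] by linarith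
  qed
  define hit where "hit S = {a \<in> K. \<exists>i\<in>S. arc i a}" for S
  define val where "val S = real (card S) - \<kappa> * real (card (hit S))" for S
  define Y where "Y = N - V - K"
  have finY: "finite (Pow Y)" by (simp add: Y_def)
  obtain O' where O': "O' \<subseteq> Y" "\<And>S. S \<subseteq> Y \<Longrightarrow> val S \<le> val O'"
  proof -
    have "val ` Pow Y \<noteq> {}" "finite (val ` Pow Y)" using finY by auto
    from Max_in[OF this(2,1)] obtain S where "S \<subseteq> Y" "val S = Max (val ` Pow Y)" by auto
    then show ?thesis using that Max_ge[OF \<open>finite (val ` Pow Y)\<close>] by auto
  qed
  have finO: "finite O'" by (rule finite_subset[OF O'(1)]) (simp add: Y_def)
  have hit_fin: "finite (hit S)" for S using fin by (simp add: hit_def)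
  show ?thesis
  proof (cases "hit O' = K")
    case False
    then obtain v' where v': "v' \<in> K" "v' \<notin> hit O'" by (auto simp: hit_def)
    \<comment> \<open>No vertex of \<open>O'\<close> has an arc to \<open>v'\<close>. Enlarging the
      maximiser \<open>O'\<close> by \<open>S\<close> cannot raise \<open>val\<close>, and
      \<open>hit\<close> is subadditive in size, so \<open>S\<close> satisfies the Hall-type
      condition with deficiency 0.\<close>
    have hall: "real (card S) \<le> 0 + \<kappa> * real (card {a \<in> K. \<exists>i\<in>S. arc i a})" if S: "S \<subseteq> N - V - K - O'" for S
    proof -
      have finS: "finite S" using S finite_subset by blast
      have "val (O' \<union> S) \<le> val O'" using S O'(1) by (intro O'(2)) (auto simp: Y_def)
      moreover have "card (O' \<union> S) = card O' + card S" using S finO finS by (intro card_Un_disjoint) auto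
      moreover have "\<kappa> * real (card (hit (O' \<union> S))) \<le> \<kappa> * (real (card (hit O')) + real (card (hit S)))"
      proof -
        have "hit (O' \<union> S) = hit O' \<union> hit S" by (auto simp: hit_def)
        then have "card (hit (O' \<union> S)) \<le> card (hit O') + card (hit S)" by (simp add: card_Un_le)
        then show ?thesis using \<kappa>(1) by (intro mult_left_mono) linarith+
      qed
      ultimately show ?thesis by (simp add: val_def hit_def algebra_simps)
    qed
    have "real r * C - 22 * (\<epsilon> * real r) * C \<le> (1 + \<gamma>) * (\<Sum>j\<in>N. \<rho> j + d v' j * \<mu> j)"
      if "\<forall>j\<in>N. 0 \<le> \<rho> j" "\<forall>j\<in>N. 0 \<le> \<mu> j" "0 \<le> C" "costly v' \<rho> \<mu> C" for \<rho> \<mu> C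
    proof (rule budget_if_sink[where V = V and K = K and O' = O' and \<psi> = 0 and \<kappa> = \<kappa>])
      show "O' \<subseteq> N" "O' \<inter> (V \<union> K) = {}" using O'(1) by (auto simp: Y_def)
      show "\<not> arc i v'" if "i \<in> O'" for i using v' that by (auto simp: hit_def)
      show "0 \<le> \<rho> j" "0 \<le> \<mu> j" if "j \<in> N" for j using \<open>\<forall>j\<in>N. 0 \<le> \<rho> j\<close> \<open>\<forall>j\<in>N. 0 \<le> \<mu> j\<close> that by auto
      show "(1 + \<gamma>) * 0 \<le> \<gamma> * real r" using gamma_nonneg by simp
      show "real (card S) \<le> 0 + \<kappa> * real (card {a \<in> K. \<exists>i\<in>S. arc i a})" if "S \<subseteq> N - V - K - O'" for S
        using that by (rule hall)
    qed (fact V fin(4) disj noarc v'(1) refl order_refl \<kappa>(1,2,3) bwd big that(3,4))+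
    then show ?thesis using v'(1) fin(4) by blast
  next
    case True
    \<comment> \<open>As \<open>O'\<close> hits all of \<open>K\<close>, \<open>val O'\<close> is at
      most \<open>card Y - \<kappa> * card K\<close>. The choice of \<open>\<kappa>\<close> bounds
      this by the allowed slack.\<close>
    have max: "(1 + \<gamma>) * val O' \<le> \<gamma> * real r"
    proof (rule ccontr)
      assume "\<not> ?thesis"
      then have less: "\<gamma> * real r < (1 + \<gamma>) * (real (card O') - \<kappa> * real (card K))"
        using True by (simp add: val_def)
      have "card O' \<le> card Y" using O'(1) by (intro card_mono) (auto simp: Y_def)
      moreover have "real (card Y) = real r - real (card V) - real (card K)"
      proof -
        have N: "N = V \<union> (K \<union> Y)" using V fin by (auto simp: Y_def)
        have "V \<inter> (K \<union> Y) = {}" "K \<inter> Y = {}" "finite Y" using disj by (auto simp: Y_def)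
        then have "card (V \<union> (K \<union> Y)) = card V + (card K + card Y)" using fin by (simp add: card_Un_disjoint)
        then have "r = card V + (card K + card Y)" unfolding N[symmetric] by simp
        then show ?thesis by simp
      qed
      ultimately have "real (card O') - \<kappa> * real (card K)
          \<le> real r - real (card V) - (1 + \<kappa>) * real (card K)" by (simp add: algebra_simps)
      then have "(1 + \<gamma>) * (real (card O') - \<kappa> * real (card K))
          \<le> (1 + \<gamma>) * (real r - real (card V) - (1 + \<kappa>) * real (card K))"
        using gamma_nonneg by (intro mult_left_mono) auto
      then have "\<gamma> * real r < (1 + \<gamma>) * (real r - real (card V) - (1 + \<kappa>) * real (card K))"
        using less by linarith
      also have "\<dots> = real r * ((1 + \<gamma>) - \<sigma> * real (card V) - (1 + \<kappa>) * (\<sigma> * real (card K)))"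
        unfolding sg(2)[symmetric] by (simp add: algebra_simps)
      also have "\<dots> \<le> real r * \<gamma>" using \<kappa>(4) by (intro mult_left_mono) auto
      finally show False by simp
    qed
    obtain v' where v': "v' \<in> K" using K_ne by auto
    have hall: "real (card S) \<le> \<gamma> * real r / (1 + \<gamma>) + \<kappa> * real (card {a \<in> K. \<exists>i\<in>S. arc i a})"
      if S: "S \<subseteq> N - V - K - {}" for S
    proof -
      have "val S \<le> val O'" using S by (intro O'(2)) (auto simp: Y_def)
      also have "\<dots> \<le> \<gamma> * real r / (1 + \<gamma>)" using max gamma_nonneg by (simp add: field_simps)
      finally show ?thesis by (simp add: val_def hit_def)
    qed
    have "real r * C - 22 * (\<epsilon> * real r) * C \<le> (1 + \<gamma>) * (\<Sum>j\<in>N. \<rho> j + d v' j * \<mu> j)"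
      if "\<forall>j\<in>N. 0 \<le> \<rho> j" "\<forall>j\<in>N. 0 \<le> \<mu> j" "0 \<le> C" "costly v' \<rho> \<mu> C" for \<rho> \<mu> C
    proof (rule budget_if_sink[where V = V and K = K and O' = "{}" and \<psi> = "\<gamma> * real r / (1 + \<gamma>)" and \<kappa> = \<kappa>])
      show "0 \<le> \<rho> j" "0 \<le> \<mu> j" if "j \<in> N" for j using \<open>\<forall>j\<in>N. 0 \<le> \<rho> j\<close> \<open>\<forall>j\<in>N. 0 \<le> \<mu> j\<close> that by auto
      show "0 \<le> \<gamma> * real r / (1 + \<gamma>)" "(1 + \<gamma>) * (\<gamma> * real r / (1 + \<gamma>)) \<le> \<gamma> * real r"
        using gamma_nonneg by auto
      show "real (card S) \<le> \<gamma> * real r / (1 + \<gamma>) + \<kappa> * real (card {a \<in> K. \<exists>i\<in>S. arc i a})"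
        if "S \<subseteq> N - V - K - {}" for S using that by (rule hall)
      show "{} \<subseteq> N" "{} \<inter> (V \<union> K) = {}" by auto
      show "\<not> arc i v'" if "i \<in> {}" for i using that by simp
    qed (fact V fin(4) disj noarc v' refl \<kappa>(1,2,3) bwd big that(3,4))+
    then show ?thesis using v' fin(4) by blast
  qed
qed

text \<open>The two sums differ only at \<open>v\<close>, where \<open>out\<close> is 0 but the loop
  has weight 1.\<close>

lemma spread_le_budget:
  assumes "costly_prices wx wy wz wu ww \<gamma> \<epsilon> r d v \<rho> \<mu> C"
  shows "costly_prices.spread r d v \<rho> \<mu> \<le> (\<Sum>j\<in>N. \<rho> j + d v j * \<mu> j)"
proof -
  interpret costly_prices wx wy wz wu ww \<gamma> \<epsilon> r d v \<rho> \<mu> C by fact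
  show ?thesis
    unfolding spread_def
  proof (rule sum_mono)
    fix j assume j: "j \<in> N"
    have "out v j * \<mu> j \<le> d v j * \<mu> j"
      using nonneg(2)[OF j] d_bounds(1)[OF v v] by (intro mult_right_mono) (auto simp: out_def)
    then show "out v j * g j + (1 - out v j) * \<rho> j \<le> \<rho> j + d v j * \<mu> j"
      by (simp add: g_def algebra_simps)
  qed
qed

text \<open>The vertex has to be fixed before the prices. Prices defeating a vertex of maximal
  out-degree contradict the spread bounds unless \<open>fwd\<close> is small. In that case they
  reveal a set \<open>V\<close> that depends on them, but the new vertex obtained from
  \<open>V\<close> works for all prices.\<close>

lemma cheap_map_exists:
  assumes small: "60 * \<epsilon> \<le> 1"
  shows "\<exists>v\<in>N. \<forall>\<rho> \<mu> C. (\<forall>j\<in>N. 0 \<le> \<rho> j) \<longrightarrow> (\<forall>j\<in>N. 0 \<le> \<mu> j) \<longrightarrow> 0 \<le> C \<longrightarrow> costly v \<rho> \<mu> C \<longrightarrow>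
    (1 - 300 * \<epsilon>) * (real r * C) \<le> (1 + \<gamma>) * (\<Sum>j\<in>N. \<rho> j + d v j * \<mu> j)"
proof (rule ccontr)
  assume neg: "\<not> ?thesis"
  obtain v where vm: "v \<in> N" "\<And>j. j \<in> N \<Longrightarrow> (\<Sum>i\<in>N. d j i) \<le> (\<Sum>i\<in>N. d v i)"
  proof -
    let ?D = "\<lambda>j. \<Sum>i\<in>N. d j i"
    have "finite (?D ` N)" "?D ` N \<noteq> {}" using r_pos by auto
    from Max_in[OF this] obtain v where "v \<in> N" "?D v = Max (?D ` N)" by auto
    then show ?thesis using that Max_ge[OF \<open>finite (?D ` N)\<close>] by auto
  qed
  have Q: "real r / 2 - 3 * (\<epsilon> * real r) \<le> (\<Sum>j\<in>N. out v j)"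
  proof -
    have "real (card N) / 2 \<le> 3 * (\<epsilon> * real r) + (\<Sum>a | a \<in> outs v \<and> (\<exists>j\<in>N. arc a j). out v a)"
      using vm r_pos by (intro in_neighbourhood_of_max_outdegree) auto
    moreover have "(\<Sum>a | a \<in> outs v \<and> (\<exists>j\<in>N. arc a j). out v a) \<le> (\<Sum>j\<in>N. out v j)"
      using out_bounds(1)[OF vm(1)] by (intro sum_mono2) (auto simp: outs_def)
    ultimately show ?thesis by simp
  qed
  have "\<not> (\<forall>\<rho> \<mu> C. (\<forall>j\<in>N. 0 \<le> \<rho> j) \<longrightarrow> (\<forall>j\<in>N. 0 \<le> \<mu> j) \<longrightarrow> 0 \<le> C \<longrightarrow> costly v \<rho> \<mu> C \<longrightarrow>
    (1 - 300 * \<epsilon>) * (real r * C) \<le> (1 + \<gamma>) * (\<Sum>j\<in>N. \<rho> j + d v j * \<mu> j))"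
    using neg vm(1) by blast
  then obtain \<rho> \<mu> C where p: "\<forall>j\<in>N. 0 \<le> \<rho> j" "\<forall>j\<in>N. 0 \<le> \<mu> j" "0 \<le> C" "costly v \<rho> \<mu> C"
    "(1 + \<gamma>) * (\<Sum>j\<in>N. \<rho> j + d v j * \<mu> j) < (1 - 300 * \<epsilon>) * (real r * C)"
    unfolding not_all not_imp not_le by blast
  interpret costly_prices wx wy wz wu ww \<gamma> \<epsilon> r d v \<rho> \<mu> C
    by unfold_locales (use vm p in auto)
  have rC: "0 \<le> real r * C" "0 \<le> \<epsilon> * (real r * C)" using p eps_pos by auto
  have "(1 + \<gamma>) * spread \<le> (1 + \<gamma>) * (\<Sum>j\<in>N. \<rho> j + d v j * \<mu> j)"
    using spread_le_budget[OF costly_prices_axioms] gamma_nonneg by (intro mult_left_mono) auto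
  then have *: "(1 + \<gamma>) * spread < (1 - 300 * \<epsilon>) * (real r * C)" using p(5) by linarith
  \<comment> \<open>The constant 300 becomes 150 on division by \<open>1 + \<gamma>\<close>, which
    is at most 2; this exceeds the values 20 and 126 needed below.\<close>
  have low: "spread < real r * C / (1 + \<gamma>) - k * (\<epsilon> * (real r * C))" if "k \<le> 150" for k
  proof -
    have "(1 + \<gamma>) * (real r * C / (1 + \<gamma>) - k * (\<epsilon> * (real r * C)))
        = real r * C - (1 + \<gamma>) * (k * (\<epsilon> * (real r * C)))"
      using gamma_nonneg by (simp add: right_diff_distrib)
    moreover have "(1 + \<gamma>) * (k * (\<epsilon> * (real r * C))) \<le> 2 * (150 * (\<epsilon> * (real r * C)))"
    proof -
      have "k * (\<epsilon> * (real r * C)) \<le> 150 * (\<epsilon> * (real r * C))" using that rC by (intro mult_right_mono)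
      then have "(1 + \<gamma>) * (k * (\<epsilon> * (real r * C))) \<le> (1 + \<gamma>) * (150 * (\<epsilon> * (real r * C)))"
        using gamma_nonneg by (intro mult_left_mono) auto
      also have "\<dots> \<le> 2 * (150 * (\<epsilon> * (real r * C)))"
        using gamma_le rC by (intro mult_right_mono) auto
      finally show ?thesis .
    qed
    ultimately have "(1 + \<gamma>) * spread < (1 + \<gamma>) * (real r * C / (1 + \<gamma>) - k * (\<epsilon> * (real r * C)))"
      using * by (simp add: algebra_simps)
    then show ?thesis using gamma_nonneg by (simp add: mult_less_cancel_left)
  qed
  have low20: "\<not> real r * C / (1 + \<gamma>) - 20 * (\<epsilon> * real r) * C \<le> spread"
    using low[of 20] by (simp add: mult.assoc)
  consider "half \<le> fwd" "half \<le> bwd" | "bwd < half" | "fwd < half" by linarith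
  then show False
  proof cases
    case 1
    then show False using spread_ge_balanced[OF p(3) Q] low20 by blast
  next
    case 2
    then show False using spread_ge_forward[OF p(3) vm(2) Q] low20 by blast
  next
    case 3
    \<comment> \<open>The slack \<open>\<alpha>\<close> is taken as \<open>60 * \<epsilon>\<close>,
      the least value that \<open>sink_from_obstruction\<close> admits, and 126 is
      \<open>2 * (60 + 3)\<close>.\<close>
    have "spread < real r * C / (1 + \<gamma>) - 2 * (60 * \<epsilon> + 3 * \<epsilon>) * real r * C"
      using low[of 126] by (simp add: algebra_simps)
    from obstruction_if_backward[OF p(3) 3 _ this] eps_pos obtain V where V: "V \<subseteq> N"
      "(\<gamma> + wy + 60 * \<epsilon>) * real r / (1 + \<gamma>)
        + kap * (\<Sum>a | a \<in> outs v \<and> (\<exists>j\<in>V. arc j a). out v a) < (\<Sum>j\<in>V. 1 - out v j)"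
      by auto
    from sink_from_obstruction[OF vm(1) Q 3 _ small V] obtain v' where v': "v' \<in> N"
      "\<And>\<rho> \<mu> C. (\<forall>j\<in>N. 0 \<le> \<rho> j) \<Longrightarrow> (\<forall>j\<in>N. 0 \<le> \<mu> j) \<Longrightarrow> 0 \<le> C \<Longrightarrow> costly v' \<rho> \<mu> C \<Longrightarrow>
        real r * C - 22 * (\<epsilon> * real r) * C \<le> (1 + \<gamma>) * (\<Sum>j\<in>N. \<rho> j + d v' j * \<mu> j)"
      by blast
    have "(1 - 300 * \<epsilon>) * (real r * C) \<le> (1 + \<gamma>) * (\<Sum>j\<in>N. \<rho> j + d v' j * \<mu> j)"
      if "\<forall>j\<in>N. 0 \<le> \<rho> j" "\<forall>j\<in>N. 0 \<le> \<mu> j" "0 \<le> C" "costly v' \<rho> \<mu> C" for \<rho> \<mu> C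
    proof -
      have "0 \<le> \<epsilon> * (real r * C)" using that eps_pos by simp
      then show ?thesis using v'(2)[OF that] by (simp add: algebra_simps)
    qed
    then show False using neg v'(1) by blast
  qed
qed

end

section \<open>From prices to distributions\<close>

lemma sum_fibres:
  fixes \<beta> :: "'v \<Rightarrow> real"
  assumes "finite (pverts F)" "\<phi> ` pverts F \<subseteq> M" "finite M" "X \<subseteq> pverts F"
  shows "(\<Sum>j\<in>M. \<rho> j * (\<Sum>v \<in> fibre F \<phi> j \<inter> X. \<beta> v)) = (\<Sum>v\<in>X. \<beta> v * \<rho> (\<phi> v))"
proof -
  have "finite X" "\<phi> ` X \<subseteq> M" using assms finite_subset by auto
  have "(\<Sum>v\<in>X. \<beta> v * \<rho> (\<phi> v)) = (\<Sum>j\<in>M. \<Sum>v \<in> {v \<in> X. \<phi> v = j}. \<beta> v * \<rho> (\<phi> v))"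
    by (rule sum.group[symmetric]) fact+
  also have "\<dots> = (\<Sum>j\<in>M. \<rho> j * (\<Sum>v \<in> fibre F \<phi> j \<inter> X. \<beta> v))"
    using assms(4) by (auto simp: fibre_def sum_distrib_left mult.commute intro!: sum.cong)
  finally show ?thesis ..
qed

lemma pverts_H0: "pverts H0 = UNIV"
  by (auto simp: H0_def) (metis H0_vertex.exhaust)

definition fold_hom :: "nat \<Rightarrow> nat \<Rightarrow> nat \<Rightarrow> nat \<Rightarrow> nat \<Rightarrow> H0_vertex \<Rightarrow> nat" where
  "fold_hom x y z u w v = (case v of Vx \<Rightarrow> x | Vy \<Rightarrow> y | Vz \<Rightarrow> z | Vu \<Rightarrow> u | Vw \<Rightarrow> w
      | Vxb \<Rightarrow> x | Vzb \<Rightarrow> z | Vub \<Rightarrow> u | Vwb \<Rightarrow> w)"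

theorem theorem6p5:
  fixes \<beta>\<^sub>0 :: "H0_vertex \<Rightarrow> real" and \<gamma> :: real
  assumes "\<beta>\<^sub>0 \<in> pverts H0 \<rightarrow> {0..1}"
    and "(\<Sum>v \<in> pverts H0. \<beta>\<^sub>0 v) = 1"
    and "\<beta>\<^sub>0 Vy \<ge> \<beta>\<^sub>0 Vx"
    and "\<gamma> = max (\<beta>\<^sub>0 Vx + \<beta>\<^sub>0 Vxb) (\<beta>\<^sub>0 Vz + \<beta>\<^sub>0 Vzb)"
  shows "gamma_good \<gamma> 1 (\<lambda>_. \<lparr> dforest = H0, droots = {Vx, Vxb}, dweight = \<beta>\<^sub>0 \<rparr>)"
proof -
  have \<beta>0: "0 \<le> \<beta>\<^sub>0 v" for v using assms(1) by (auto simp: pverts_H0)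
  have \<beta>1: "\<beta>\<^sub>0 Vx + \<beta>\<^sub>0 Vy + \<beta>\<^sub>0 Vz + \<beta>\<^sub>0 Vu + \<beta>\<^sub>0 Vw + \<beta>\<^sub>0 Vxb + \<beta>\<^sub>0 Vzb + \<beta>\<^sub>0 Vub + \<beta>\<^sub>0 Vwb = 1"
    using assms(2) by (simp add: H0_def)
  interpret merged_weights "\<beta>\<^sub>0 Vx + \<beta>\<^sub>0 Vxb" "\<beta>\<^sub>0 Vy" "\<beta>\<^sub>0 Vz + \<beta>\<^sub>0 Vzb" "\<beta>\<^sub>0 Vu + \<beta>\<^sub>0 Vub"
      "\<beta>\<^sub>0 Vw + \<beta>\<^sub>0 Vwb" \<gamma>
  proof
    show "\<gamma> \<le> 1" unfolding assms(4) using \<beta>1 \<beta>0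
      by (smt (verit))
  qed (use \<beta>0 \<beta>1 assms(4) in auto)
  have "\<exists>j\<^sub>t \<in> {1..r}. \<exists>P :: ((H0_vertex \<Rightarrow> nat) \<times> nat) pmf.
           (AE (\<phi>, i) in measure_pmf P.
              i \<in> {1..1} \<and> weighted_hom H0 r d \<phi> \<and> j\<^sub>t \<notin> \<phi> ` {Vx, Vxb}) \<and>
           (\<forall>j \<in> {1..r}.
              measure_pmf.expectation P (\<lambda>(\<phi>, i). \<Sum>v \<in> fibre H0 \<phi> j. \<beta>\<^sub>0 v)
              \<le> (1 + \<gamma> + \<alpha>) / real r) \<and>
           (\<forall>j \<in> {1..r}.
              measure_pmf.expectation P (\<lambda>(\<phi>, i). \<Sum>v \<in> fibre H0 \<phi> j \<inter> {Vx, Vxb}. \<beta>\<^sub>0 v)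
              \<le> d j\<^sub>t j * ((1 + \<gamma> + \<alpha>) / real r))"
    if \<alpha>: "0 < \<alpha>" and e: "0 < \<epsilon>" "\<epsilon> \<le> min \<alpha> 1 / 2000" and r: "1 \<le> \<epsilon> * real r"
      and d: "eps_complete \<epsilon> r d" for \<alpha> \<epsilon> r d
  proof -
    interpret eps_digraph "\<beta>\<^sub>0 Vx + \<beta>\<^sub>0 Vxb" "\<beta>\<^sub>0 Vy" "\<beta>\<^sub>0 Vz + \<beta>\<^sub>0 Vzb" "\<beta>\<^sub>0 Vu + \<beta>\<^sub>0 Vub"
        "\<beta>\<^sub>0 Vw + \<beta>\<^sub>0 Vwb" \<gamma> \<epsilon> r d
      by unfold_locales (use e r d in auto)
    \<comment> \<open>One \<open>a\<close> pays for the loss of the factor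
      \<open>1 - 300 * \<epsilon>\<close>, at most \<open>900 * \<epsilon>\<close>; a second one
      pays for the error \<open>\<delta>\<close> of the approximate minimax.\<close>
    define a where "a = min \<alpha> 1 / 2"
    have a: "0 < a" "a \<le> 1/2" "2 * a \<le> \<alpha>" "1000 * \<epsilon> \<le> a" using \<alpha> e by (auto simp: a_def)
    have "60 * \<epsilon> \<le> 1" using a by simp
    from cheap_map_exists[OF this] obtain v where v: "v \<in> N" "\<And>\<rho> \<mu> C.
        (\<forall>j\<in>N. 0 \<le> \<rho> j) \<Longrightarrow> (\<forall>j\<in>N. 0 \<le> \<mu> j) \<Longrightarrow> 0 \<le> C \<Longrightarrow> costly v \<rho> \<mu> C \<Longrightarrow>
        (1 - 300 * \<epsilon>) * (real r * C) \<le> (1 + \<gamma>) * (\<Sum>j\<in>N. \<rho> j + d v j * \<mu> j)"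
      by blast
    have rp: "0 < real r" using r_pos by simp
    have not_costly: "\<not> costly v \<rho> \<mu> ((1 + \<gamma> + a) / real r * (\<Sum>j\<in>N. \<rho> j + d v j * \<mu> j))"
      if nn: "\<forall>j\<in>N. 0 \<le> \<rho> j" "\<forall>j\<in>N. 0 \<le> \<mu> j" for \<rho> \<mu>
    proof
      define B where "B = (\<Sum>j\<in>N. \<rho> j + d v j * \<mu> j)"
      assume cost: "costly v \<rho> \<mu> ((1 + \<gamma> + a) / real r * (\<Sum>j\<in>N. \<rho> j + d v j * \<mu> j))"
      have nn': "0 \<le> \<rho> j + d v j * \<mu> j" if "j \<in> N" for j using that nn d_bounds(1)[OF v(1)] by simp
      have B0: "0 \<le> B" unfolding B_def using nn' by (intro sum_nonneg)
      have "0 \<le> (1 + \<gamma> + a) / real r * B" using B0 a gamma_nonneg by simp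
      from v(2)[OF nn this] cost have "(1 - 300 * \<epsilon>) * ((1 + \<gamma> + a) * B) \<le> (1 + \<gamma>) * B"
        using rp by (simp add: B_def)
      then have "((1 - 300 * \<epsilon>) * (1 + \<gamma> + a) - (1 + \<gamma>)) * B \<le> 0" by (simp add: algebra_simps)
      moreover have "0 < (1 - 300 * \<epsilon>) * (1 + \<gamma> + a) - (1 + \<gamma>)"
      proof -
        have "300 * \<epsilon> * (1 + \<gamma> + a) \<le> 300 * \<epsilon> * 3" using a gamma_le e by (intro mult_left_mono) auto
        then show ?thesis using a e by (simp add: algebra_simps)
      qed
      ultimately have "B = 0" using B0 by (simp add: mult_le_0_iff)
      then have zero: "\<rho> j + d v j * \<mu> j = 0" if "j \<in> N" for j
        using that nn' unfolding B_def by (subst (asm) sum_nonneg_eq_0_iff) auto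
      have rho0: "\<rho> j = 0" "d v j * \<mu> j = 0" if "j \<in> N" for j
        using zero[OF that] nn that mult_nonneg_nonneg[OF d_bounds(1)[OF v(1) that], of "\<mu> j"]
        by (auto simp: add_nonneg_eq_0_iff)
      \<comment> \<open>With budget 0 all relevant prices vanish, so being costly at level 0 means
        that there is no admissible homomorphism at all. Then level 1 is costly vacuously, which the
        choice of \<open>v\<close> rules out.\<close>
      have "costly v \<rho> \<mu> 1"
        unfolding costly_def
      proof (intro ballI impI)
        fix x y z u w
        assume *: "x \<in> N" "y \<in> N" "z \<in> N" "u \<in> N" "w \<in> N" "x \<noteq> v" "arc v x" "arc x y" "arc z x" "arc z u" "arc w z"
        have "\<mu> x = 0" using rho0(2)[OF *(1)] *(7) by (simp add: arc_def)
        moreover have "0 < (\<beta>\<^sub>0 Vx + \<beta>\<^sub>0 Vxb) * (\<rho> x + \<mu> x) + \<beta>\<^sub>0 Vy * \<rho> y + (\<beta>\<^sub>0 Vz + \<beta>\<^sub>0 Vzb) * \<rho> z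
            + (\<beta>\<^sub>0 Vu + \<beta>\<^sub>0 Vub) * \<rho> u + (\<beta>\<^sub>0 Vw + \<beta>\<^sub>0 Vwb) * \<rho> w"
          using cost * \<open>B = 0\<close> unfolding costly_def B_def by simp
        ultimately show "1 < (\<beta>\<^sub>0 Vx + \<beta>\<^sub>0 Vxb) * (\<rho> x + \<mu> x) + \<beta>\<^sub>0 Vy * \<rho> y + (\<beta>\<^sub>0 Vz + \<beta>\<^sub>0 Vzb) * \<rho> z
            + (\<beta>\<^sub>0 Vu + \<beta>\<^sub>0 Vub) * \<rho> u + (\<beta>\<^sub>0 Vw + \<beta>\<^sub>0 Vwb) * \<rho> w"
          using rho0(1)[OF *(1)] rho0(1)[OF *(2)] rho0(1)[OF *(3)] rho0(1)[OF *(4)] rho0(1)[OF *(5)] by simp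
      qed
      from v(2)[OF nn _ this] have "(1 - 300 * \<epsilon>) * real r \<le> 0" using \<open>B = 0\<close> by (simp add: B_def)
      moreover have "0 < (1 - 300 * \<epsilon>) * real r" using rp a by simp
      ultimately show False by simp
    qed
    define \<Phi> where "\<Phi> = {\<phi> \<in> pverts H0 \<rightarrow>\<^sub>E N. weighted_hom H0 r d \<phi> \<and> \<phi> Vx \<in> outs v \<and> \<phi> Vxb \<in> outs v}"
    have fin\<Phi>: "finite (\<Phi> \<times> {1::nat})"
      unfolding \<Phi>_def by (simp add: finite_PiE H0_def)
    \<comment> \<open>The index \<open>False\<close> marks constraint (2) and \<open>True\<close>
      constraint (3).\<close>
    define I where "I = {False, True} \<times> N"
    define X where "X b = (if b then {Vx, Vxb} else pverts H0)" for b
    define f where "f p k = (\<Sum>v \<in> fibre H0 (fst p) (snd k) \<inter> X (fst k). \<beta>\<^sub>0 v)"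
      for p :: "(H0_vertex \<Rightarrow> nat) \<times> nat" and k :: "bool \<times> nat"
    define c where "c k = (if fst k then d v (snd k) else 1) * ((1 + \<gamma> + a) / real r)" for k :: "bool \<times> nat"
    define pos where "pos = {j \<in> N. 0 < d v j}"
    \<comment> \<open>Constraint (3) is exact where \<open>d v j = 0\<close>; elsewhere an additive error \<open>\<delta>\<close> is harmless.\<close>
    define \<delta> where "\<delta> = Min ((\<lambda>j. d v j * (a / real r)) ` pos)"
    have vpos: "v \<in> pos" using v(1) d_refl by (simp add: pos_def)
    have \<delta>le: "\<delta> \<le> d v j * (a / real r)" if "j \<in> pos" for j
      unfolding \<delta>_def using that by (intro Min_le) (auto simp: pos_def)
    have "\<delta> \<in> (\<lambda>j. d v j * (a / real r)) ` pos"
      unfolding \<delta>_def using vpos by (intro Min_in) (auto simp: pos_def)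
    then have \<delta>0: "0 < \<delta>" using a rp by (auto simp: pos_def)
    have \<delta>1: "\<delta> \<le> a / real r" using \<delta>le[OF vpos] d_refl[OF v(1)] by simp
    have sumI: "(\<Sum>k\<in>I. F k) = (\<Sum>j\<in>N. F (False, j)) + (\<Sum>j\<in>N. F (True, j))" for F :: "bool \<times> nat \<Rightarrow> real"
    proof -
      have "(\<Sum>k\<in>I. F k) = (\<Sum>b\<in>{False, True}. \<Sum>j\<in>N. F (b, j))"
        unfolding I_def by (subst sum.cartesian_product) simp
      then show ?thesis by simp
    qed
    have "\<exists>P. set_pmf P \<subseteq> \<Phi> \<times> {1::nat} \<and> (\<forall>k\<in>I. measure_pmf.expectation P (\<lambda>p. f p k) \<le> c k + \<delta>)"
    proof (rule approachability[OF _ fin\<Phi> \<delta>0])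
      show "finite I" by (simp add: I_def)
      fix w :: "bool \<times> nat \<Rightarrow> real"
      assume w: "\<And>k. k \<in> I \<Longrightarrow> 0 \<le> w k"
      define \<rho> where "\<rho> j = w (False, j)" for j
      define \<mu> where "\<mu> j = w (True, j)" for j
      have "\<forall>j\<in>N. 0 \<le> \<rho> j" "\<forall>j\<in>N. 0 \<le> \<mu> j" using w by (auto simp: \<rho>_def \<mu>_def I_def)
      from not_costly[OF this] obtain x y z u t where h: "x \<in> N" "y \<in> N" "z \<in> N" "u \<in> N" "t \<in> N"
          "x \<noteq> v" "arc v x" "arc x y" "arc z x" "arc z u" "arc t z" and
        cost: "(\<beta>\<^sub>0 Vx + \<beta>\<^sub>0 Vxb) * (\<rho> x + \<mu> x) + \<beta>\<^sub>0 Vy * \<rho> y + (\<beta>\<^sub>0 Vz + \<beta>\<^sub>0 Vzb) * \<rho> z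
            + (\<beta>\<^sub>0 Vu + \<beta>\<^sub>0 Vub) * \<rho> u + (\<beta>\<^sub>0 Vw + \<beta>\<^sub>0 Vwb) * \<rho> t
            \<le> (1 + \<gamma> + a) / real r * (\<Sum>j\<in>N. \<rho> j + d v j * \<mu> j)"
        unfolding costly_def not_less[symmetric] by blast
      define \<phi> where "\<phi> = fold_hom x y z u t"
      have \<phi>N: "\<phi> v \<in> N" for v using h by (cases v) (auto simp: \<phi>_def fold_hom_def)
      have xo: "x \<in> outs v" using h by (auto simp: outs_def out_def arc_def)
      have hom: "weighted_hom H0 r d \<phi>"
        unfolding weighted_hom_def using h \<phi>N
        by (auto simp: pverts_H0) (auto simp: H0_def \<phi>_def fold_hom_def arc_def)
      then have "(\<phi>, 1) \<in> \<Phi> \<times> {1}"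
        using xo by (auto simp: \<Phi>_def weighted_hom_def) (auto simp: \<phi>_def fold_hom_def)
      moreover have "(\<Sum>k\<in>I. w k * f (\<phi>, 1) k) \<le> (\<Sum>k\<in>I. w k * c k)"
      proof -
        have "(\<Sum>k\<in>I. w k * f (\<phi>, 1) k)
            = (\<Sum>j\<in>N. \<rho> j * (\<Sum>v \<in> fibre H0 \<phi> j \<inter> pverts H0. \<beta>\<^sub>0 v)) + (\<Sum>j\<in>N. \<mu> j * (\<Sum>v \<in> fibre H0 \<phi> j \<inter> {Vx, Vxb}. \<beta>\<^sub>0 v))"
          unfolding sumI by (simp add: f_def X_def \<rho>_def \<mu>_def)
        also have "\<dots> = (\<Sum>v\<in>pverts H0. \<beta>\<^sub>0 v * \<rho> (\<phi> v)) + (\<Sum>v\<in>{Vx, Vxb}. \<beta>\<^sub>0 v * \<mu> (\<phi> v))"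
          using \<phi>N by (subst (1 2) sum_fibres) (auto simp: H0_def)
        also have "\<dots> = (\<beta>\<^sub>0 Vx + \<beta>\<^sub>0 Vxb) * (\<rho> x + \<mu> x) + \<beta>\<^sub>0 Vy * \<rho> y + (\<beta>\<^sub>0 Vz + \<beta>\<^sub>0 Vzb) * \<rho> z
            + (\<beta>\<^sub>0 Vu + \<beta>\<^sub>0 Vub) * \<rho> u + (\<beta>\<^sub>0 Vw + \<beta>\<^sub>0 Vwb) * \<rho> t"
          by (simp add: H0_def \<phi>_def fold_hom_def algebra_simps)
        also have "\<dots> \<le> (1 + \<gamma> + a) / real r * (\<Sum>j\<in>N. \<rho> j + d v j * \<mu> j)" by (rule cost)
        also have "\<dots> = (\<Sum>k\<in>I. w k * c k)"
          unfolding sumI by (simp add: c_def \<rho>_def \<mu>_def sum_distrib_left sum.distrib[symmetric] algebra_simps)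
        finally show ?thesis .
      qed
      ultimately show "\<exists>p\<in>\<Phi> \<times> {1}. (\<Sum>k\<in>I. w k * f p k) \<le> (\<Sum>k\<in>I. w k * c k)" by blast
    qed
    then obtain P where P: "set_pmf P \<subseteq> \<Phi> \<times> {1}" "\<And>k. k \<in> I \<Longrightarrow> measure_pmf.expectation P (\<lambda>p. f p k) \<le> c k + \<delta>"
      by blast
    have AE: "AE (\<phi>, i) in measure_pmf P. i \<in> {1..1} \<and> weighted_hom H0 r d \<phi> \<and> v \<notin> \<phi> ` {Vx, Vxb}"
      using P(1) outsD by (auto simp: AE_measure_pmf_iff \<Phi>_def)
    have a\<alpha>: "(1 + \<gamma> + a) / real r + a / real r \<le> (1 + \<gamma> + \<alpha>) / real r"
      using a rp by (simp add: add_divide_distrib[symmetric] divide_right_mono)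
    have E1: "measure_pmf.expectation P (\<lambda>(\<phi>, i). \<Sum>v \<in> fibre H0 \<phi> j. \<beta>\<^sub>0 v) \<le> (1 + \<gamma> + \<alpha>) / real r" if "j \<in> N" for j
    proof -
      have "(\<lambda>(\<phi>, i). \<Sum>v \<in> fibre H0 \<phi> j. \<beta>\<^sub>0 v) = (\<lambda>p. f p (False, j))"
        by (auto simp: f_def X_def fibre_def fun_eq_iff intro!: sum.cong)
      then show ?thesis using P(2)[of "(False, j)"] that \<delta>1 a\<alpha> by (simp add: I_def c_def)
    qed
    have E2: "measure_pmf.expectation P (\<lambda>(\<phi>, i). \<Sum>v \<in> fibre H0 \<phi> j \<inter> {Vx, Vxb}. \<beta>\<^sub>0 v)
        \<le> d v j * ((1 + \<gamma> + \<alpha>) / real r)" if j: "j \<in> N" for j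
    proof (cases "j \<in> pos")
      case True
      have "(\<lambda>(\<phi>, i). \<Sum>v \<in> fibre H0 \<phi> j \<inter> {Vx, Vxb}. \<beta>\<^sub>0 v) = (\<lambda>p. f p (True, j))"
        by (auto simp: f_def X_def fun_eq_iff)
      then have "measure_pmf.expectation P (\<lambda>(\<phi>, i). \<Sum>v \<in> fibre H0 \<phi> j \<inter> {Vx, Vxb}. \<beta>\<^sub>0 v)
          \<le> d v j * ((1 + \<gamma> + a) / real r) + d v j * (a / real r)"
        using P(2)[of "(True, j)"] j \<delta>le[OF True] by (simp add: I_def c_def)
      also have "\<dots> = d v j * ((1 + \<gamma> + a) / real r + a / real r)" by (simp add: distrib_left)
      also have "\<dots> \<le> d v j * ((1 + \<gamma> + \<alpha>) / real r)" using a\<alpha> d_bounds(1)[OF v(1) j] by (intro mult_left_mono)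
      finally show ?thesis .
    next
      case False
      then have dj: "d v j = 0" using d_bounds(1)[OF v(1) j] j by (auto simp: pos_def)
      have "(case p of (\<phi>, i) \<Rightarrow> \<Sum>v \<in> fibre H0 \<phi> j \<inter> {Vx, Vxb}. \<beta>\<^sub>0 v) = 0" if "p \<in> set_pmf P" for p
      proof -
        obtain \<phi> i where p: "p = (\<phi>, i)" by (cases p)
        then have "\<phi> Vx \<in> outs v" "\<phi> Vxb \<in> outs v" using that P(1) by (auto simp: \<Phi>_def)
        then have "fibre H0 \<phi> j \<inter> {Vx, Vxb} = {}" using dj by (auto simp: fibre_def outs_def out_def split: if_splits)
        then show ?thesis using p by simp
      qed
      then have "measure_pmf.expectation P (\<lambda>(\<phi>, i). \<Sum>v \<in> fibre H0 \<phi> j \<inter> {Vx, Vxb}. \<beta>\<^sub>0 v)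
          = measure_pmf.expectation P (\<lambda>_. 0)"
        by (intro integral_cong_AE) (auto simp: AE_measure_pmf_iff)
      then show ?thesis using dj by simp
    qed
    show ?thesis using v(1) AE E1 E2 by (intro bexI[of _ v] exI[of _ P]) auto
  qed
  note main = this
  show ?thesis
    unfolding gamma_good_def
  proof (intro conjI ballI allI impI)
    show "0 \<le> \<gamma>" by (rule gamma_nonneg)
    show "distillation \<lparr> dforest = H0, droots = {Vx, Vxb}, dweight = \<beta>\<^sub>0 \<rparr>"
      using assms(1,2) by (rule distillation_H0)
    fix \<alpha> :: real assume \<alpha>: "0 < \<alpha>"
    have "\<exists>r\<^sub>0. \<forall>r\<ge>r\<^sub>0. 1 \<le> \<epsilon> * real r" if "0 < \<epsilon>" for \<epsilon> :: real
    proof -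
      obtain r0 :: nat where "1 / \<epsilon> \<le> real r0" using real_arch_simple by blast
      then have "1 \<le> \<epsilon> * real r0" using that by (simp add: field_simps)
      moreover have "\<epsilon> * real r0 \<le> \<epsilon> * real r" if "r0 \<le> r" for r using that \<open>0 < \<epsilon>\<close> by simp
      ultimately show ?thesis by (meson order_trans)
    qed
    with main[OF \<alpha>] \<alpha> show "\<exists>\<epsilon>\<^sub>0>0. \<forall>\<epsilon>. 0 < \<epsilon> \<and> \<epsilon> \<le> \<epsilon>\<^sub>0 \<longrightarrow>
       (\<exists>r\<^sub>0. \<forall>r\<ge>r\<^sub>0. \<forall>d. eps_complete \<epsilon> r d \<longrightarrow>
         (\<exists>j\<^sub>t \<in> {1..r}. \<exists>P :: ((H0_vertex \<Rightarrow> nat) \<times> nat) pmf.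
           (AE (\<phi>, i) in measure_pmf P.
              i \<in> {1..1} \<and> weighted_hom (dforest \<lparr> dforest = H0, droots = {Vx, Vxb}, dweight = \<beta>\<^sub>0 \<rparr>) r d \<phi>
                \<and> j\<^sub>t \<notin> \<phi> ` droots \<lparr> dforest = H0, droots = {Vx, Vxb}, dweight = \<beta>\<^sub>0 \<rparr>) \<and>
           (\<forall>j \<in> {1..r}.
              measure_pmf.expectation P
                (\<lambda>(\<phi>, i). \<Sum>v \<in> fibre (dforest \<lparr> dforest = H0, droots = {Vx, Vxb}, dweight = \<beta>\<^sub>0 \<rparr>) \<phi> j.
                   dweight \<lparr> dforest = H0, droots = {Vx, Vxb}, dweight = \<beta>\<^sub>0 \<rparr> v)
              \<le> (1 + \<gamma> + \<alpha>) / real r) \<and>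
           (\<forall>j \<in> {1..r}.
              measure_pmf.expectation P
                (\<lambda>(\<phi>, i). \<Sum>v \<in> fibre (dforest \<lparr> dforest = H0, droots = {Vx, Vxb}, dweight = \<beta>\<^sub>0 \<rparr>) \<phi> j
                     \<inter> droots \<lparr> dforest = H0, droots = {Vx, Vxb}, dweight = \<beta>\<^sub>0 \<rparr>.
                   dweight \<lparr> dforest = H0, droots = {Vx, Vxb}, dweight = \<beta>\<^sub>0 \<rparr> v)
              \<le> d j\<^sub>t j * ((1 + \<gamma> + \<alpha>) / real r))))"
      unfolding distillation_data.simps
      by (intro exI[of _ "min \<alpha> 1 / 2000"]) (simp, blast)
  qed
qed

end
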